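(* Let $K\ge 1$ and $m$ be positive integers. For $k=1,\dots,K$ let $\sigma_k^2>0$, $P_k>0$, $\lambda_k\in[0,1)$, and let $\mathcal N_0>0$. Let $\vartheta_{k,l}$ ($0\le k\le K$, $1\le l\le m$) be independent circularly-symmetric complex Gaussian random variables with zero mean and unit variance, and define $$|h_k|=\sqrt{\tfrac{\sigma_k^2}{m}}\,\Big\|\sqrt{1-\lambda_k^2}\,(\vartheta_{k,1},\dots,\vartheta_{k,m})^T+\lambda_k(\vartheta_{0,1},\dots,\vartheta_{0,m})^T\Big\|,\qquad \gamma_k=\frac{P_k|h_k|^2}{\mathcal N_0},$$ and $G_K=\prod_{k=1}^K(1+\gamma_k)$. Put $\Omega_k=\frac{P_k\sigma_k^2(1-\lambda_k^2)}{m\mathcal N_0}$, $w_k=\frac{\lambda_k^2}{1-\lambda_k^2}\big(1+\sum_{l=1}^K\frac{\lambda_l^2}{1-\lambda_l^2}\big)^{-1}$, and for $\boldsymbol\ell=(\ell_1,\dots,\ell_K)\in\mathbb N_0^K$ $$W_{\boldsymbol\ell}=\frac{\Gamma(m+\sum_{k=1}^K\ell_k)}{\Gamma(m)}\Big(1+\sum_{k=1}^K\frac{\lambda_k^2}{1-\lambda_k^2}\Big)^{-m}\prod_{k=1}^K\frac{w_k^{\ell_k}}{\ell_k!}.$$ For each $\boldsymbol\ell$ let $R_{\boldsymbol\ell,1},\dots,R_{\boldsymbol\ell,K}$ be independent with $R_{\boldsymbol\ell,k}\sim\mathcal G(m+\ell_k,\Omega_k)$, let $\mathcal A_{\boldsymbol\ell}=\prod_{k=1}^K(1+R_{\boldsymbol\ell,k})$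 and let $F_{\mathcal A_{\boldsymbol\ell}}$ be its CDF. Then the CDF of $G_K$ is $$F_{G_K}(x)=\sum_{\ell_1,\dots,\ell_K=0}^\infty W_{\boldsymbol\ell}\,F_{\mathcal A_{\boldsymbol\ell}}(x),$$ and $$F_{\mathcal A_{\boldsymbol\ell}}(x)=Y_{1,K+1}^{K,1}\left[\left.\begin{array}{c}(1,1,0,1)\\ (1,1,\tfrac{1}{\Omega_1},m+\ell_1),\dots,(1,1,\tfrac{1}{\Omega_K},m+\ell_K),(0,1,0,1)\end{array}\right|\frac{x}{\prod_{k=1}^K\Omega_k}\right].$$
   Context: $\mathcal G(a,b)$ denotes the Gamma distribution with shape $a$ and scale $b$, i.e. density $x^{a-1}e^{-x/b}/(\Gamma(a)b^a)$ on $x>0$. $\Psi(\alpha,\gamma;z)=\frac{1}{\Gamma(\alpha)}\int_0^\infty e^{-zt}t^{\alpha-1}(1+t)^{\gamma-\alpha-1}dt$ is Tricomi's confluent hypergeometric function. The generalized Fox H function is defined by the Mellin–Barnes integral $$Y_{p,q}^{m,n}\left[\left.\begin{array}{c}(a_1,\alpha_1,A_1,\varphi_1),\dots,(a_p,\alpha_p,A_p,\varphi_p)\\(b_1,\beta_1,B_1,\phi_1),\dots,(b_q,\beta_q,B_q,\phi_q)\end{array}\right|x\right]=\frac{1}{2\pi i}\int_{\mathcal L}M_{p,q}^{m,n}[s]\,x^{-s}ds,$$ where $\mathcal L$ is a contour from $c-i\infty$ to $c+i\infty$ ($c\in\mathbb R$) and $$M_{p,q}^{m,n}[s]=\frac{\prod_{j=1}^m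 B_j^{\phi_j+b_j+\beta_js-1}\Psi(\phi_j,\phi_j+b_j+\beta_js;B_j)}{\prod_{i=n+1}^p A_i^{\varphi_i+a_i+\alpha_is-1}\Psi(\varphi_i,\varphi_i+a_i+\alpha_is;A_i)}\cdot\frac{\prod_{i=1}^n A_i^{\varphi_i-a_i-\alpha_is}\Psi(\varphi_i,\varphi_i+1-a_i-\alpha_is;A_i)}{\prod_{j=m+1}^q B_j^{\phi_j-b_j-\beta_js}\Psi(\phi_j,\phi_j+1-b_j-\beta_js;B_j)}.$$
   Formalization: In Y, a factor A^{c-1}Ψ(φ,c;A) with A=0, where Ψ diverges, is read as its limit Γ(c-1)/Γ(φ) as A→0+; the contour is any vertical line Re s=c with c<0, and the Y formula is stated for x>0. *)

theory Defs
  imports "HOL-Probability.Probability"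
begin

definition gamma_density :: "real \<Rightarrow> real \<Rightarrow> real \<Rightarrow> real" where
  "gamma_density a b x =
     (if x > 0 then x powr (a - 1) * exp (- x / b) / (Gamma a * b powr a) else 0)"

definition cscg_density :: "complex \<Rightarrow> real" where
  "cscg_density z = exp (- (cmod z)\<^sup>2) / pi"

definition prod_gamma_cdf :: "nat \<Rightarrow> (nat \<Rightarrow> real) \<Rightarrow> (nat \<Rightarrow> real) \<Rightarrow> real \<Rightarrow> real" where
  "prod_gamma_cdf K a b x =
     (let N = PiM {1..K} (\<lambda>k. density lborel (\<lambda>r. ennreal (gamma_density (a k) (b k) r)))
      in measure N {r \<in> space N. (\<Prod>k\<in>{1..K}. 1 + r k) \<le> x})"

definition tricomi_Psi :: "real \<Rightarrow> complex \<Rightarrow> real \<Rightarrow> complex" where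
  "tricomi_Psi \<alpha> \<gamma> z =
     complex_of_real (1 / Gamma \<alpha>) *
     (LINT t:{0<..}|lborel. complex_of_real (exp (- z * t) * t powr (\<alpha> - 1))
                            * (complex_of_real (1 + t)) powr (\<gamma> - \<alpha> - 1))"

text \<open>The factor A^(c-1) Psi(phi, c; A) appearing in the generalized Fox H kernel.
  For A = 0 it is read as its limit A -> 0+, namely Gamma(c-1)/Gamma(phi) (valid for Re c > 1).\<close>
definition yfac :: "real \<Rightarrow> real \<Rightarrow> complex \<Rightarrow> complex" where
  "yfac A \<phi> c =
     (if A = 0 then Gamma (c - 1) / complex_of_real (Gamma \<phi>)
      else (complex_of_real A) powr (c - 1) * tricomi_Psi \<phi> c A)"

type_synonym yparam = "real \<times> real \<times> real \<times> real"

definition Yfac_plus :: "yparam \<Rightarrow> complex \<Rightarrow> complex" where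
  "Yfac_plus = (\<lambda>(b, \<beta>, B, \<phi>) s. yfac B \<phi> (\<phi> + b + \<beta> * s))"

definition Yfac_minus :: "yparam \<Rightarrow> complex \<Rightarrow> complex" where
  "Yfac_minus = (\<lambda>(a, \<alpha>, A, \<phi>) s. yfac A \<phi> (\<phi> + 1 - a - \<alpha> * s))"

definition Y_kernel :: "nat \<Rightarrow> nat \<Rightarrow> nat \<Rightarrow> nat \<Rightarrow> (nat \<Rightarrow> yparam) \<Rightarrow> (nat \<Rightarrow> yparam) \<Rightarrow> complex \<Rightarrow> complex" where
  "Y_kernel m n p q ap bp s =
     (\<Prod>j\<in>{1..m}. Yfac_plus (bp j) s) / (\<Prod>i\<in>{n+1..p}. Yfac_plus (ap i) s)
     * ((\<Prod>i\<in>{1..n}. Yfac_minus (ap i) s) / (\<Prod>j\<in>{m+1..q}. Yfac_minus (bp j) s))"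

text \<open>Generalized Fox H function Y^{m,n}_{p,q}, with the Mellin--Barnes integral taken along the
  vertical line Re s = c: (1/(2 pi i)) int_{c-i oo}^{c+i oo} M(s) x^(-s) ds, parametrised by s = c + i y.\<close>
definition foxY :: "nat \<Rightarrow> nat \<Rightarrow> nat \<Rightarrow> nat \<Rightarrow> (nat \<Rightarrow> yparam) \<Rightarrow> (nat \<Rightarrow> yparam) \<Rightarrow> real \<Rightarrow> real \<Rightarrow> complex" where
  "foxY m n p q ap bp c x =
     complex_of_real (1 / (2 * pi)) *
     (LINT y|lborel. Y_kernel m n p q ap bp (Complex c y)
                      * (complex_of_real x) powr (- Complex c y))"

end

(*
  Let mu_k = lambda_k / sqrt (1 - lambda_k^2). Then gamma_k = Omega_k * |theta_k + mu_k theta_0|^2.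
  Given theta_0, each |theta_k + mu_k theta_0|^2 is a Poisson (mu_k^2 U) mixture of Gamma (m + l, 1)
  laws, where U = |theta_0|^2 has law Gamma (m, 1): for one real coordinate this is the power series of
  cosh, and the sum over coordinates follows from the convolution rules for Gamma and Poisson laws.
  Integrating the product of the Poisson weights over U gives the weights W, first on boxes and hence
  for the joint law of (gamma_1, ..., gamma_K).

  With s on the line Re s = c < 0, the kernel of the Fox function is E[A^s] / (- s) up to a power of the
  scales, and E[A^s] / (- s) is the Fourier transform of exp (c u) P (ln A <= u). Integration by parts
  makes it absolutely integrable, so Fourier inversion recovers the distribution function of A.
*)

theory Submission
  imports Defs
begin

section \<open>Gamma distributions and their Poisson mixtures\<close>

text \<open>Laws are compared through \<open>\<integral>\<^sup>+\<close> of arbitrary nonnegative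
  Borel functions, so that sums over the Poisson indices and integrals may be exchanged without
  integrability conditions.

  A shifted complex Gaussian vector has a squared norm whose law depends on the shift only through
  its norm. Hence all K conditional laws depend on theta_0 through the one scalar U. The
  exponentials of the Poisson weights merge with the factor exp (-U) of its density into exp (-S U),
  where S = 1 + sum mu_k^2. This is the origin of S, of w_k = mu_k^2 / S and of the power S^(-m).

  An event such as {A <= x} does not factor over k even when theta_0 is fixed. This is why boxes are
  treated first and the joint law is identified before the product is formed.

  The sign of c matters twice: A >= 1 gives |A^s| <= 1 when Re s < 0, and exp (c u) makes the
  distribution function of ln A integrable at +infinity. The difficult case of the inversion is K =
  1, where the trivial bound 1 / |s| on the transform is not integrable.\<close>

definition gamma_measure :: "real \<Rightarrow> real \<Rightarrow> real measure" where
  "gamma_measure a b = density lborel (\<lambda>r. ennreal (gamma_density a b r))"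

lemma gamma_density_measurable [measurable]: "gamma_density a b \<in> borel_measurable borel"
  unfolding gamma_density_def[abs_def] by measurable

lemma gamma_density_nonneg: "a > 0 \<Longrightarrow> b > 0 \<Longrightarrow> gamma_density a b r \<ge> 0"
  by (simp add: gamma_density_def)

lemma sets_gamma_measure [measurable_cong, simp]: "sets (gamma_measure a b) = sets borel"
  by (simp add: gamma_measure_def)

lemma space_gamma_measure [simp]: "space (gamma_measure a b) = UNIV"
  by (simp add: gamma_measure_def)

lemma nn_integral_gamma_measure:
  "f \<in> borel_measurable borel \<Longrightarrow>
     (\<integral>\<^sup>+r. f r \<partial>gamma_measure a b) = (\<integral>\<^sup>+r. ennreal (gamma_density a b r) * f r \<partial>lborel)"
  unfolding gamma_measure_def by (subst nn_integral_density) auto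

text \<open>Substitution r -> b r, with \<open>*\<close> as the scaling law of the density. It lets
  the convolution and mixture lemmas stay at scale 1; the scales \<Omega> enter only in
  \<open>nn_integral_block\<close>.\<close>

lemma nn_integral_gamma_measure_scale:
  assumes [measurable]: "f \<in> borel_measurable borel" and "a > 0" "b > 0"
  shows "(\<integral>\<^sup>+r. f (b * r) \<partial>gamma_measure a 1) = (\<integral>\<^sup>+r. f r \<partial>gamma_measure a b)"
proof -
  have *: "b * gamma_density a b (b * r) = gamma_density a 1 r" for r
    using assms(2,3) by (auto simp: gamma_density_def powr_mult zero_less_mult_iff powr_diff field_simps)
  have "(\<integral>\<^sup>+r. f r \<partial>gamma_measure a b) = ennreal b * (\<integral>\<^sup>+r. ennreal (gamma_density a b (b * r)) * f (b * r) \<partial>lborel)"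
    using assms(3) by (subst nn_integral_gamma_measure, simp, subst nn_integral_real_affine[where c = b and t = 0]) auto
  also have "\<dots> = (\<integral>\<^sup>+r. ennreal (gamma_density a 1 r) * f (b * r) \<partial>lborel)"
    using assms(3) by (subst nn_integral_cmult[symmetric])
      (auto simp flip: * simp: ennreal_mult' mult_ac)
  also have "\<dots> = (\<integral>\<^sup>+r. f (b * r) \<partial>gamma_measure a 1)"
    by (subst nn_integral_gamma_measure) auto
  finally show ?thesis ..
qed

lemma prob_space_gamma_measure:
  assumes "a > 0" "b > 0"
  shows "prob_space (gamma_measure a b)"
proof
  have "emeasure (gamma_measure a b) (space (gamma_measure a b)) = (\<integral>\<^sup>+r. 1 \<partial>gamma_measure a b)"
    by simp
  also have "\<dots> = (\<integral>\<^sup>+r. 1 \<partial>gamma_measure a 1)"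
    using nn_integral_gamma_measure_scale[of "\<lambda>_. 1" a b] assms by simp
  also have "\<dots> = (\<integral>\<^sup>+r. ennreal (gamma_density a 1 r) \<partial>lborel)"
    by (subst nn_integral_gamma_measure) auto
  also have "\<dots> = (\<integral>\<^sup>+r. ennreal (1 / Gamma a) * ennreal (indicator {0..} r * r powr (a - 1) / exp r) \<partial>lborel)"
    using assms Gamma_real_pos[of a]
    by (intro nn_integral_cong_AE eventually_mono[OF AE_lborel_singleton[of 0]])
       (auto simp: gamma_density_def exp_minus field_simps simp flip: ennreal_mult' split: split_indicator)
  also have "\<dots> = ennreal (1 / Gamma a) * ennreal (Gamma a)"
    using assms by (subst nn_integral_cmult) (auto simp: Gamma_conv_nn_integral_real)
  also have "\<dots> = 1"
    using Gamma_real_pos[OF assms(1)] by (simp add: Gamma_real_pos[OF assms(1), THEN less_imp_neq, symmetric] flip: ennreal_mult')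
  finally show "emeasure (gamma_measure a b) (space (gamma_measure a b)) = 1" .
qed

text \<open>For s > 0 the substitution q = s t pulls out s^(a+b-1) exp (-s) and leaves the Beta
  integral over [0, 1], whose value Gamma a Gamma b / Gamma (a + b) gives the right
  normalisation.\<close>

lemma gamma_density_convolution:
  assumes a: "a > 0" and b: "b > 0"
  shows "(\<integral>\<^sup>+q. ennreal (gamma_density a 1 q * gamma_density b 1 (s - q)) \<partial>lborel)
           = ennreal (gamma_density (a + b) 1 s)"
proof (cases "s > 0")
  case False
  then have *: "gamma_density a 1 q * gamma_density b 1 (s - q) = 0" for q
    by (auto simp: gamma_density_def)
  show ?thesis using False by (simp only: *) (simp add: gamma_density_def)
next
  case True
  define c where "c = s powr (a + b - 1) * exp (- s) / (Gamma a * Gamma b)"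
  have G: "Gamma a > 0" "Gamma b > 0" "Gamma (a + b) > 0"
    using a b by (auto intro: Gamma_real_pos)
  have c: "c \<ge> 0" using G by (simp add: c_def)
  have "(\<integral>\<^sup>+q. ennreal (gamma_density a 1 q * gamma_density b 1 (s - q)) \<partial>lborel)
      = ennreal s * (\<integral>\<^sup>+t. ennreal (gamma_density a 1 (s * t) * gamma_density b 1 (s - s * t)) \<partial>lborel)"
    using True by (subst nn_integral_real_affine[where c = s and t = 0]) auto
  also have "\<dots> = (\<integral>\<^sup>+t. ennreal s * ennreal (gamma_density a 1 (s * t) * gamma_density b 1 (s - s * t)) \<partial>lborel)"
    by (subst nn_integral_cmult) auto
  also have "\<dots> = (\<integral>\<^sup>+t. ennreal c * ennreal (indicator {0..1} t * (t powr (a - 1) * (1 - t) powr (b - 1))) \<partial>lborel)"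
  proof (intro nn_integral_cong_AE eventually_mono[OF eventually_conj[OF AE_lborel_singleton[of 0] AE_lborel_singleton[of 1]]])
    fix t :: real assume t: "t \<noteq> 0 \<and> t \<noteq> 1"
    have "s * (gamma_density a 1 (s * t) * gamma_density b 1 (s - s * t))
        = c * (indicator {0..1} t * (t powr (a - 1) * (1 - t) powr (b - 1)))"
    proof (cases "0 < t \<and> t < 1")
      case False
      then have "t \<notin> {0..1}" "\<not> (s * t > 0 \<and> s - s * t > 0)"
        using t True by (auto simp: zero_less_mult_iff)
      then show ?thesis by (auto simp: gamma_density_def)
    next
      case T: True
      have "s - s * t = s * (1 - t)" by (simp add: algebra_simps)
      moreover have "s * t > 0" "s * (1 - t) > 0" using T True by auto
      moreover have "exp (- s) = exp (- (s * t)) * exp (- (s * (1 - t)))"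
        by (simp add: algebra_simps flip: exp_add)
      moreover have "s powr (a + b - 1) = s * (s powr (a - 1) * s powr (b - 1))"
        using True by (simp add: powr_diff powr_add)
      ultimately show ?thesis
        using T True by (simp add: gamma_density_def c_def powr_mult)
    qed
    then show "ennreal s * ennreal (gamma_density a 1 (s * t) * gamma_density b 1 (s - s * t))
        = ennreal c * ennreal (indicator {0..1} t * (t powr (a - 1) * (1 - t) powr (b - 1)))"
      using True c by (simp flip: ennreal_mult')
  qed
  also have "\<dots> = ennreal c * (\<integral>\<^sup>+t. ennreal (indicator {0..1} t * (t powr (a - 1) * (1 - t) powr (b - 1))) \<partial>lborel)"
    by (subst nn_integral_cmult) auto
  also have "(\<integral>\<^sup>+t. ennreal (indicator {0..1} t * (t powr (a - 1) * (1 - t) powr (b - 1))) \<partial>lborel) = ennreal (Beta a b)"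
    using nn_integral_has_integral_lebesgue[OF _ has_integral_Beta_real[OF a b]] by simp
  also have "ennreal c * ennreal (Beta a b) = ennreal (gamma_density (a + b) 1 s)"
    using c G True by (simp add: gamma_density_def c_def Beta_def flip: ennreal_mult')
  finally show ?thesis .
qed

lemma nn_integral_gamma_measure_convolution:
  assumes [measurable]: "f \<in> borel_measurable borel" and a: "a > 0" and b: "b > 0"
  shows "(\<integral>\<^sup>+q. (\<integral>\<^sup>+r. f (q + r) \<partial>gamma_measure b 1) \<partial>gamma_measure a 1) = (\<integral>\<^sup>+r. f r \<partial>gamma_measure (a + b) 1)"
proof -
  have "(\<integral>\<^sup>+q. (\<integral>\<^sup>+r. f (q + r) \<partial>gamma_measure b 1) \<partial>gamma_measure a 1)
     = (\<integral>\<^sup>+q. ennreal (gamma_density a 1 q) * (\<integral>\<^sup>+r. ennreal (gamma_density b 1 r) * f (q + r) \<partial>lborel) \<partial>lborel)"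
    by (simp add: nn_integral_gamma_measure)
  also have "\<dots> = (\<integral>\<^sup>+q. ennreal (gamma_density a 1 q) * (\<integral>\<^sup>+s. ennreal (gamma_density b 1 (s - q)) * f s \<partial>lborel) \<partial>lborel)"
  proof (rule nn_integral_cong)
    fix q :: real
    have "(\<integral>\<^sup>+s. ennreal (gamma_density b 1 (s - q)) * f s \<partial>lborel) = (\<integral>\<^sup>+r. ennreal (gamma_density b 1 r) * f (q + r) \<partial>lborel)"
      by (subst nn_integral_real_affine[where c = 1 and t = q]) auto
    then show "ennreal (gamma_density a 1 q) * (\<integral>\<^sup>+r. ennreal (gamma_density b 1 r) * f (q + r) \<partial>lborel)
       = ennreal (gamma_density a 1 q) * (\<integral>\<^sup>+s. ennreal (gamma_density b 1 (s - q)) * f s \<partial>lborel)" by simp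
  qed
  also have "\<dots> = (\<integral>\<^sup>+q. (\<integral>\<^sup>+s. ennreal (gamma_density a 1 q * gamma_density b 1 (s - q)) * f s \<partial>lborel) \<partial>lborel)"
    using a b by (subst nn_integral_cmult[symmetric]) (auto simp: ennreal_mult gamma_density_nonneg mult.assoc)
  also have "\<dots> = (\<integral>\<^sup>+s. (\<integral>\<^sup>+q. ennreal (gamma_density a 1 q * gamma_density b 1 (s - q)) * f s \<partial>lborel) \<partial>lborel)"
    by (rule lborel_pair.Fubini') measurable
  also have "\<dots> = (\<integral>\<^sup>+s. ennreal (gamma_density (a + b) 1 s) * f s \<partial>lborel)"
    by (simp add: nn_integral_multc gamma_density_convolution a b)
  also have "\<dots> = (\<integral>\<^sup>+r. f r \<partial>gamma_measure (a + b) 1)"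
    by (simp add: nn_integral_gamma_measure)
  finally show ?thesis .
qed

section \<open>Poisson mixtures of Gamma laws and their convolution\<close>

definition poisson_weight :: "real \<Rightarrow> nat \<Rightarrow> real" where
  "poisson_weight \<delta> n = exp (- \<delta>) * \<delta> ^ n / fact n"

lemma poisson_weight_nonneg: "\<delta> \<ge> 0 \<Longrightarrow> poisson_weight \<delta> n \<ge> 0"
  by (simp add: poisson_weight_def)

lemma poisson_weight_convolution:
  "(\<Sum>i\<le>n. poisson_weight \<delta> i * poisson_weight \<epsilon> (n - i)) = poisson_weight (\<delta> + \<epsilon>) n"
proof -
  have "(\<Sum>i\<le>n. poisson_weight \<delta> i * poisson_weight \<epsilon> (n - i))
      = (\<Sum>i\<le>n. exp (- (\<delta> + \<epsilon>)) / fact n * (of_nat (n choose i) * \<delta> ^ i * \<epsilon> ^ (n - i)))"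
    by (intro sum.cong) (auto simp: poisson_weight_def binomial_fact exp_add[symmetric] exp_minus field_simps)
  also have "\<dots> = poisson_weight (\<delta> + \<epsilon>) n"
    by (simp add: poisson_weight_def binomial_ring sum_distrib_left sum_divide_distrib)
  finally show ?thesis .
qed

text \<open>Equivalently, the law of half a noncentral chi-squared variable with 2 a degrees of freedom and
  noncentrality 2 \<delta>.\<close>

definition noncentral_gamma :: "real \<Rightarrow> real \<Rightarrow> real measure" where
  "noncentral_gamma \<delta> a =
     density lborel (\<lambda>r. \<Sum>n. ennreal (poisson_weight \<delta> n) * ennreal (gamma_density (a + real n) 1 r))"

lemma sets_noncentral_gamma [measurable_cong, simp]: "sets (noncentral_gamma \<delta> a) = sets borel"
  by (simp add: noncentral_gamma_def)

lemma nn_integral_noncentral_gamma: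
  assumes [measurable]: "f \<in> borel_measurable borel"
  shows "(\<integral>\<^sup>+r. f r \<partial>noncentral_gamma \<delta> a)
           = (\<Sum>n. ennreal (poisson_weight \<delta> n) * (\<integral>\<^sup>+r. f r \<partial>gamma_measure (a + real n) 1))"
proof -
  have "(\<integral>\<^sup>+r. f r \<partial>noncentral_gamma \<delta> a)
     = (\<integral>\<^sup>+r. (\<Sum>n. ennreal (poisson_weight \<delta> n) * (ennreal (gamma_density (a + real n) 1 r) * f r)) \<partial>lborel)"
    unfolding noncentral_gamma_def
    by (subst nn_integral_density) (auto simp flip: ennreal_suminf_multc simp: mult.assoc)
  also have "\<dots> = (\<Sum>n. ennreal (poisson_weight \<delta> n) * (\<integral>\<^sup>+r. f r \<partial>gamma_measure (a + real n) 1))"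
    by (subst nn_integral_suminf) (auto simp: nn_integral_cmult nn_integral_gamma_measure)
  finally show ?thesis .
qed

text \<open>Shifting row i by i places turns antidiagonals into columns; Tonelli for counting
  measures then exchanges the two sums, with no summability condition since all terms are in
  \<open>ennreal\<close>.\<close>

lemma suminf_ennreal_Cauchy:
  fixes g :: "nat \<Rightarrow> nat \<Rightarrow> ennreal"
  shows "(\<Sum>i. \<Sum>j. g i j) = (\<Sum>n. \<Sum>i\<le>n. g i (n - i))"
proof -
  have shift: "(\<Sum>j. g i j) = (\<Sum>n. if i \<le> n then g i (n - i) else 0)" for i
    by (subst suminf_offset[where i = i]) (auto simp: summableI)
  have "(\<Sum>i. \<Sum>j. g i j) = (\<integral>\<^sup>+i. \<integral>\<^sup>+n. (if i \<le> n then g i (n - i) else 0) \<partial>count_space UNIV \<partial>count_space UNIV)"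
    by (simp add: shift nn_integral_count_space_nat)
  also have "\<dots> = (\<integral>\<^sup>+n. \<integral>\<^sup>+i. (if i \<le> n then g i (n - i) else 0) \<partial>count_space UNIV \<partial>count_space UNIV)"
    by (rule nn_integral_count_space_nn_integral) auto
  also have "\<dots> = (\<Sum>n. \<Sum>i. if i \<le> n then g i (n - i) else 0)"
    by (simp add: nn_integral_count_space_nat)
  also have "\<dots> = (\<Sum>n. \<Sum>i\<le>n. g i (n - i))"
    by (intro suminf_cong, subst suminf_finite[where N = "{.._}"]) auto
  finally show ?thesis .
qed

text \<open>Noncentralities and shapes both add. Gamma convolution merges the components with
  indices i and j into shape a + b + (i + j), and the Poisson convolution sums the weights with i +
  j = n.\<close>

lemma nn_integral_noncentral_gamma_convolution:
  assumes f[measurable]: "f \<in> borel_measurable borel" and a: "a > 0" and b: "b > 0"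
    and \<delta>: "\<delta> \<ge> 0" and \<epsilon>: "\<epsilon> \<ge> 0"
  shows "(\<integral>\<^sup>+q. (\<integral>\<^sup>+r. f (q + r) \<partial>noncentral_gamma \<epsilon> b) \<partial>noncentral_gamma \<delta> a)
           = (\<integral>\<^sup>+r. f r \<partial>noncentral_gamma (\<delta> + \<epsilon>) (a + b))"
proof -
  interpret sigma_finite_measure "gamma_measure (b + real j) 1" for j
    using prob_space_gamma_measure[of "b + real j" 1] b
    by (simp add: prob_space_imp_sigma_finite)
  define I where "I n = (\<integral>\<^sup>+r. f r \<partial>gamma_measure (a + b + real n) 1)" for n
  have "(\<integral>\<^sup>+q. (\<integral>\<^sup>+r. f (q + r) \<partial>noncentral_gamma \<epsilon> b) \<partial>noncentral_gamma \<delta> a)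
     = (\<integral>\<^sup>+q. (\<Sum>j. ennreal (poisson_weight \<epsilon> j) * (\<integral>\<^sup>+r. f (q + r) \<partial>gamma_measure (b + real j) 1)) \<partial>noncentral_gamma \<delta> a)"
    by (simp add: nn_integral_noncentral_gamma)
  also have "\<dots> = (\<Sum>j. ennreal (poisson_weight \<epsilon> j) *
        (\<integral>\<^sup>+q. (\<integral>\<^sup>+r. f (q + r) \<partial>gamma_measure (b + real j) 1) \<partial>noncentral_gamma \<delta> a))"
    by (simp add: nn_integral_suminf nn_integral_cmult)
  \<comment> \<open>The integral now depends on the two indices only through their sum, so
    antidiagonals can be collected.\<close>
  also have "\<dots> = (\<Sum>j. \<Sum>i. ennreal (poisson_weight \<epsilon> j) * (ennreal (poisson_weight \<delta> i) * I (j + i)))"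
    using a b by (simp add: nn_integral_noncentral_gamma nn_integral_gamma_measure_convolution I_def add_ac)
  also have "\<dots> = (\<Sum>n. \<Sum>j\<le>n. ennreal (poisson_weight \<epsilon> j) * (ennreal (poisson_weight \<delta> (n - j)) * I n))"
    by (subst suminf_ennreal_Cauchy) (auto intro!: suminf_cong sum.cong)
  also have "\<dots> = (\<Sum>n. ennreal (\<Sum>j\<le>n. poisson_weight \<epsilon> j * poisson_weight \<delta> (n - j)) * I n)"
    using \<delta> \<epsilon> by (simp add: poisson_weight_nonneg sum_distrib_right ennreal_mult mult.assoc flip: sum_ennreal)
  also have "\<dots> = (\<integral>\<^sup>+r. f r \<partial>noncentral_gamma (\<delta> + \<epsilon>) (a + b))"
    by (simp add: nn_integral_noncentral_gamma poisson_weight_convolution I_def add.commute[of \<epsilon>])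
  finally show ?thesis .
qed

text \<open>The substitution r = x^2 is made on [0, n + 1] and carried to the half-line by monotone
  convergence; the endpoint 0 is a null set.\<close>

lemma nn_integral_square_substitution:
  fixes F :: "real \<Rightarrow> ennreal"
  assumes [measurable]: "F \<in> borel_measurable borel"
  shows "(\<integral>\<^sup>+r. F r * indicator {0<..} r \<partial>lborel) = (\<integral>\<^sup>+x. F (x\<^sup>2) * ennreal (2 * x) * indicator {0<..} x \<partial>lborel)"
proof -
  have *: "(\<integral>\<^sup>+r. F r * indicator {0..(real (Suc n))\<^sup>2} r \<partial>lborel)
      = (\<integral>\<^sup>+x. F (x\<^sup>2) * ennreal (2 * x) * indicator {0..real (Suc n)} x \<partial>lborel)" for n
  proof -
    have "((\<lambda>x. x\<^sup>2) has_real_derivative 2 * x) (at x)" for x :: real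
      by (auto intro!: derivative_eq_intros)
    then show ?thesis
      using nn_integral_substitution_aux[of F 0 "real (Suc n)" "\<lambda>x. x\<^sup>2" "\<lambda>x. 2 * x"]
      by (auto intro!: continuous_intros)
  qed
  \<comment> \<open>One limit lemma for both sides: g is the square on the left and the identity on
    the right. Using \<open>Suc n\<close> stays in the range x >= 1, where x^2 >= x, so that the
    intervals exhaust the half-line.\<close>
  have lim: "(\<Squnion>n. (\<integral>\<^sup>+r. H r * indicator {0..g (real (Suc n))} r \<partial>lborel)) = (\<integral>\<^sup>+r. H r * indicator {0..} r \<partial>lborel)"
    if [measurable]: "H \<in> borel_measurable borel" and g: "\<And>x y. 0 \<le> x \<Longrightarrow> x \<le> y \<Longrightarrow> g x \<le> g y" "\<And>x. 1 \<le> x \<Longrightarrow> g x \<ge> x"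
    for H :: "real \<Rightarrow> ennreal" and g :: "real \<Rightarrow> real"
  proof (subst nn_integral_monotone_convergence_SUP[symmetric])
    show "incseq (\<lambda>n r. H r * indicator {0..g (real (Suc n))} r)"
      using g(1)[of "real (Suc _)" "real (Suc _)"]
      by (auto simp: incseq_def le_fun_def split: split_indicator) force
    have "(\<Squnion>n. H r * indicator {0..g (real (Suc n))} r) = H r * indicator {0..} r" for r
    proof (cases "r \<ge> 0")
      case True
      obtain n where n: "r \<le> real n" using real_arch_simple by blast
      have "r \<le> g (real (Suc n))" using g(2)[of "real (Suc n)"] n by simp
      with True show ?thesis
        by (intro antisym SUP_least SUP_upper2[of n]) (auto split: split_indicator)
    qed auto
    then show "(\<integral>\<^sup>+ r. (\<Squnion>n. H r * indicator {0..g (real (Suc n))} r) \<partial>lborel) = (\<integral>\<^sup>+ r. H r * indicator {0..} r \<partial>lborel)"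
      by simp
  qed auto
  have z: "(\<integral>\<^sup>+r. H r * indicator {0<..} r \<partial>lborel) = (\<integral>\<^sup>+r. H r * indicator {0..} r \<partial>lborel)" for H :: "real \<Rightarrow> ennreal"
    by (intro nn_integral_cong_AE eventually_mono[OF AE_lborel_singleton[of 0]]) (auto split: split_indicator)
  have "(\<integral>\<^sup>+r. F r * indicator {0..} r \<partial>lborel) = (\<Squnion>n. (\<integral>\<^sup>+r. F r * indicator {0..(real (Suc n))\<^sup>2} r \<partial>lborel))"
    by (rule lim[symmetric, where g = "\<lambda>x. x\<^sup>2"]) (auto intro: power_mono simp: self_le_power)
  also have "\<dots> = (\<Squnion>n. (\<integral>\<^sup>+x. F (x\<^sup>2) * ennreal (2 * x) * indicator {0..real (Suc n)} x \<partial>lborel))"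
    by (simp only: *)
  also have "\<dots> = (\<integral>\<^sup>+x. F (x\<^sup>2) * ennreal (2 * x) * indicator {0..} x \<partial>lborel)"
    by (rule lim[where g = "\<lambda>x. x"]) auto
  finally show ?thesis by (simp add: z)
qed

section \<open>Noncentral Gaussian vectors\<close>

text \<open>The duplication formula at half-integers. The left side is the denominator produced by a
  Poisson weight and a Gamma density of shape n + 1/2; the right side contains the (2 n)! of the
  cosh series.\<close>

lemma fact_mult_Gamma_half:
  "fact n * Gamma (real n + 1 / 2) = fact (2 * n) * sqrt pi / 4 ^ n"
proof (induction n)
  case (Suc n)
  have "real n + 1 / 2 \<noteq> 0" by linarith
  moreover have "real n + 1 / 2 \<notin> \<int>\<^sub>\<le>\<^sub>0"
    by (auto elim!: nonpos_Ints_cases)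
  ultimately have "Gamma (real (Suc n) + 1 / 2) = (real n + 1 / 2) * Gamma (real n + 1 / 2)"
    using Gamma_plus1[of "real n + 1 / 2"] by (simp add: add_ac)
  then have "fact (Suc n) * Gamma (real (Suc n) + 1 / 2)
      = real (Suc n) * (real n + 1 / 2) * (fact n * Gamma (real n + 1 / 2))"
    by simp
  also have "\<dots> = real (Suc n) * (real n + 1 / 2) * (fact (2 * n) * sqrt pi / 4 ^ n)"
    by (simp only: Suc.IH)
  also have "\<dots> = fact (2 * Suc n) * sqrt pi / 4 ^ Suc n"
    by (simp add: field_simps)
  finally show ?case .
qed (simp add: Gamma_one_half_real)

text \<open>The right side is the density of |Y| for Y normal with mean a and variance 1/2, and
  \<open>2 * x\<close> is the Jacobian of r = x^2. Expanding the squares gives 2 exp (- a^2 - x^2)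
  cosh (2 a x), whose power series matches the mixture term by term.\<close>

lemma poisson_gamma_half_sums:
  assumes x: "x > 0"
  shows "(\<lambda>n. poisson_weight (a\<^sup>2) n * gamma_density (1 / 2 + real n) 1 (x\<^sup>2) * (2 * x)) sums
    ((exp (- (x - a)\<^sup>2) + exp (- (x + a)\<^sup>2)) / sqrt pi)"
proof -
  \<comment> \<open>The library series for cosh runs over all exponents with zeros at the odd ones;
    reindexing keeps the even ones.\<close>
  have "(\<lambda>n. (2 * a * x) ^ (2 * n) /\<^sub>R fact (2 * n)) sums cosh (2 * a * x)"
    using cosh_converges[of "2 * a * x"]
    by (subst (asm) sums_mono_reindex[of "\<lambda>n. 2 * n", symmetric]) (auto simp: strict_mono_def elim!: evenE)
  then have "(\<lambda>n. exp (- a\<^sup>2 - x\<^sup>2) * 2 / sqrt pi * ((2 * a * x) ^ (2 * n) /\<^sub>R fact (2 * n)))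
      sums (exp (- a\<^sup>2 - x\<^sup>2) * 2 / sqrt pi * cosh (2 * a * x))"
    by (rule sums_mult)
  moreover have "exp (- a\<^sup>2 - x\<^sup>2) * 2 / sqrt pi * ((2 * a * x) ^ (2 * n) /\<^sub>R fact (2 * n))
      = poisson_weight (a\<^sup>2) n * gamma_density (1 / 2 + real n) 1 (x\<^sup>2) * (2 * x)" for n
  proof -
    have "(x\<^sup>2) powr (real n - 1 / 2) = (x\<^sup>2) ^ n / x"
      using x by (simp add: powr_diff powr_realpow powr_half_sqrt)
    then have "poisson_weight (a\<^sup>2) n * gamma_density (1 / 2 + real n) 1 (x\<^sup>2) * (2 * x)
       = exp (- a\<^sup>2 - x\<^sup>2) * 2 * (a\<^sup>2) ^ n * (x\<^sup>2) ^ n / (fact n * Gamma (real n + 1 / 2))"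
      using x by (simp add: poisson_weight_def gamma_density_def exp_diff exp_minus field_simps)
    also have "\<dots> = exp (- a\<^sup>2 - x\<^sup>2) * 2 / sqrt pi * ((2 * a * x) ^ (2 * n) /\<^sub>R fact (2 * n))"
    proof -
      have sq: "(y\<^sup>2) ^ n = (y ^ n)\<^sup>2" for y :: real
        by (simp add: mult.commute flip: power_mult)
      show ?thesis
        unfolding fact_mult_Gamma_half using sq[of 2]
        by (simp add: power_mult power_mult_distrib sq field_simps)
    qed
    finally show ?thesis ..
  qed
  moreover have "exp (- a\<^sup>2 - x\<^sup>2) * 2 / sqrt pi * cosh (2 * a * x) = (exp (- (x - a)\<^sup>2) + exp (- (x + a)\<^sup>2)) / sqrt pi"
  proof -
    have "exp (- (x - a)\<^sup>2) = exp (- a\<^sup>2 - x\<^sup>2) * exp (2 * a * x)"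
      "exp (- (x + a)\<^sup>2) = exp (- a\<^sup>2 - x\<^sup>2) * exp (- (2 * a * x))"
      unfolding exp_add[symmetric] by (simp_all add: power2_diff power2_sum mult_ac)
    then show ?thesis by (simp add: cosh_def distrib_left add_divide_distrib)
  qed
  ultimately show ?thesis by simp
qed

text \<open>The weight is the normal density of variance 1/2, that is, one real coordinate of a
  circular Gaussian of unit variance. In the variable x with r = x^2 the mixture density becomes the
  folded normal density, which is unfolded over the real line.\<close>

lemma nn_integral_gauss_square:
  assumes [measurable]: "f \<in> borel_measurable borel"
  shows "(\<integral>\<^sup>+x. ennreal (exp (- x\<^sup>2) / sqrt pi) * f ((x + a)\<^sup>2) \<partial>lborel) = (\<integral>\<^sup>+r. f r \<partial>noncentral_gamma (a\<^sup>2) (1 / 2))"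
proof -
  let ?g = "\<lambda>n r. ennreal (gamma_density (1 / 2 + real n) 1 r)"
  let ?e = "\<lambda>x. ennreal (exp (- x\<^sup>2) / sqrt pi)"
  have "(\<integral>\<^sup>+r. f r \<partial>noncentral_gamma (a\<^sup>2) (1 / 2))
      = (\<Sum>n. ennreal (poisson_weight (a\<^sup>2) n) * (\<integral>\<^sup>+r. ?g n r * f r \<partial>lborel))"
    by (simp add: nn_integral_noncentral_gamma nn_integral_gamma_measure)
  also have "\<dots> = (\<Sum>n. ennreal (poisson_weight (a\<^sup>2) n) *
      (\<integral>\<^sup>+x. (?g n (x\<^sup>2) * f (x\<^sup>2)) * ennreal (2 * x) * indicator {0<..} x \<partial>lborel))"
  proof -
    have "(\<integral>\<^sup>+r. ?g n r * f r \<partial>lborel)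
        = (\<integral>\<^sup>+x. (?g n (x\<^sup>2) * f (x\<^sup>2)) * ennreal (2 * x) * indicator {0<..} x \<partial>lborel)" for n
      by (subst nn_integral_square_substitution[symmetric], simp, rule nn_integral_cong)
         (simp add: gamma_density_def split: split_indicator)
    then show ?thesis by (simp only:)
  qed
  also have "\<dots> = (\<Sum>n. (\<integral>\<^sup>+x. ennreal (poisson_weight (a\<^sup>2) n) *
      ((?g n (x\<^sup>2) * f (x\<^sup>2)) * ennreal (2 * x) * indicator {0<..} x) \<partial>lborel))"
    by (subst nn_integral_cmult) auto
  also have "\<dots> = (\<integral>\<^sup>+x. (\<Sum>n. ennreal (poisson_weight (a\<^sup>2) n) *
      ((?g n (x\<^sup>2) * f (x\<^sup>2)) * ennreal (2 * x) * indicator {0<..} x)) \<partial>lborel)"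
    by (subst nn_integral_suminf) auto
  also have "\<dots> = (\<integral>\<^sup>+x. (?e (x - a) * f (x\<^sup>2) + ?e (x + a) * f (x\<^sup>2)) * indicator {0<..} x \<partial>lborel)"
  proof (rule nn_integral_cong)
    fix x :: real
    show "(\<Sum>n. ennreal (poisson_weight (a\<^sup>2) n) * ((?g n (x\<^sup>2) * f (x\<^sup>2)) * ennreal (2 * x) * indicator {0<..} x))
       = (?e (x - a) * f (x\<^sup>2) + ?e (x + a) * f (x\<^sup>2)) * indicator {0<..} x"
    proof (cases "x > 0")
      case True
      have nn: "poisson_weight (a\<^sup>2) n * gamma_density (1 / 2 + real n) 1 (x\<^sup>2) * (2 * x) \<ge> 0" for n
        using True by (intro mult_nonneg_nonneg poisson_weight_nonneg gamma_density_nonneg) auto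
      have "(\<Sum>n. ennreal (poisson_weight (a\<^sup>2) n) * ((?g n (x\<^sup>2) * f (x\<^sup>2)) * ennreal (2 * x) * indicator {0<..} x))
          = (\<Sum>n. ennreal (poisson_weight (a\<^sup>2) n * gamma_density (1 / 2 + real n) 1 (x\<^sup>2) * (2 * x)) * f (x\<^sup>2))"
        using True by (intro suminf_cong)
          (simp add: ennreal_mult poisson_weight_nonneg gamma_density_nonneg mult_ac)
      also have "\<dots> = ennreal ((exp (- (x - a)\<^sup>2) + exp (- (x + a)\<^sup>2)) / sqrt pi) * f (x\<^sup>2)"
        using suminf_ennreal_eq[OF nn poisson_gamma_half_sums[OF True]] by simp
      also have "ennreal ((exp (- (x - a)\<^sup>2) + exp (- (x + a)\<^sup>2)) / sqrt pi) = ?e (x - a) + ?e (x + a)"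
        by (simp add: add_divide_distrib)
      finally show ?thesis using True by (simp add: distrib_right)
    qed simp
  qed
  also have "\<dots> = (\<integral>\<^sup>+x. ?e (x - a) * f (x\<^sup>2) * indicator {0<..} x \<partial>lborel)
      + (\<integral>\<^sup>+x. ?e (x + a) * f (x\<^sup>2) * indicator {0<..} x \<partial>lborel)"
    by (subst nn_integral_add[symmetric]) (auto simp: distrib_right)
  \<comment> \<open>Reflection x -> -x moves the second half of the folded density to the negative
    half-line, so that the two halves join to one integral over the line.\<close>
  also have "(\<integral>\<^sup>+x. ?e (x + a) * f (x\<^sup>2) * indicator {0<..} x \<partial>lborel)
      = (\<integral>\<^sup>+x. ?e (x - a) * f (x\<^sup>2) * indicator {..<0} x \<partial>lborel)"
    by (subst nn_integral_real_affine[where c = "-1" and t = 0])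
       (auto intro!: nn_integral_cong simp: power2_commute[of _ a] add.commute split: split_indicator)
  also have "(\<integral>\<^sup>+x. ?e (x - a) * f (x\<^sup>2) * indicator {0<..} x \<partial>lborel) + \<dots>
      = (\<integral>\<^sup>+x. ?e (x - a) * f (x\<^sup>2) \<partial>lborel)"
    by (subst nn_integral_add[symmetric], simp, simp,
        intro nn_integral_cong_AE eventually_mono[OF AE_lborel_singleton[of 0]])
       (auto split: split_indicator)
  also have "\<dots> = (\<integral>\<^sup>+x. ?e x * f ((x + a)\<^sup>2) \<partial>lborel)"
    by (subst nn_integral_real_affine[where c = 1 and t = a]) (auto simp: add.commute)
  finally show ?thesis ..
qed

section \<open>The circular complex Gaussian law and its product\<close>

text \<open>Boxes for the basis {1, i} are rectangles, and values on boxes determine Lebesgue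
  measure. This opens complex integrals to Fubini in real and imaginary part.\<close>

lemma lborel_complex: "(lborel :: complex measure) = distr (lborel \<Otimes>\<^sub>M lborel) borel (\<lambda>(x, y). Complex x y)"
proof (rule lborel_eqI)
  have [measurable]: "(\<lambda>(x, y). Complex x y) \<in> borel_measurable (borel \<Otimes>\<^sub>M borel)"
    unfolding borel_measurable_complex_iff by (simp add: case_prod_unfold)
  fix l u :: complex
  assume "\<And>b. b \<in> Basis \<Longrightarrow> l \<bullet> b \<le> u \<bullet> b"
  from this[of 1] this[of \<i>] have lu: "Re l \<le> Re u" "Im l \<le> Im u"
    by (simp_all add: inner_complex_def)
  have "(\<lambda>(x, y). Complex x y) -` box l u \<inter> space (lborel \<Otimes>\<^sub>M lborel) = {Re l<..<Re u} \<times> {Im l<..<Im u}"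
    by (auto simp: box_def Basis_complex_def space_pair_measure)
  then have "emeasure (distr (lborel \<Otimes>\<^sub>M lborel) borel (\<lambda>(x, y). Complex x y)) (box l u)
     = emeasure (lborel \<Otimes>\<^sub>M lborel) ({Re l<..<Re u} \<times> {Im l<..<Im u})"
    by (subst emeasure_distr) auto
  also have "\<dots> = ennreal (Re u - Re l) * ennreal (Im u - Im l)"
    using lu by (subst lborel.emeasure_pair_measure_Times) auto
  also have "\<dots> = ennreal (\<Prod>b\<in>Basis. (u - l) \<bullet> b)"
    using lu by (simp add: Basis_complex_def inner_complex_def ennreal_mult')
  finally show "emeasure (distr (lborel \<Otimes>\<^sub>M lborel) borel (\<lambda>(x, y). Complex x y)) (box l u) = ennreal (\<Prod>b\<in>Basis. (u - l) \<bullet> b)" .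
qed simp

definition cscg_measure :: "complex measure" where
  "cscg_measure = density lborel (\<lambda>z. ennreal (cscg_density z))"

lemma sets_cscg_measure [measurable_cong, simp]: "sets cscg_measure = sets borel"
  by (simp add: cscg_measure_def)

lemma cscg_density_measurable [measurable]: "cscg_density \<in> borel_measurable borel"
  unfolding cscg_density_def[abs_def] by measurable

text \<open>The total mass is the sum of the Poisson weights, which is 1. Sigma-finiteness makes
  inner integrals against the mixture measurable in an outer variable.\<close>

lemma noncentral_gamma_sigma_finite:
  assumes "\<delta> \<ge> 0" "a > 0"
  shows "sigma_finite_measure (noncentral_gamma \<delta> a)"
proof -
  have "(\<integral>\<^sup>+r. 1 \<partial>noncentral_gamma \<delta> a) = (\<Sum>n. ennreal (poisson_weight \<delta> n))"
    using assms prob_space.emeasure_space_1[OF prob_space_gamma_measure[of "a + real _" 1]]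
    by (subst nn_integral_noncentral_gamma) auto
  also have "\<dots> = 1"
  proof -
    have "(\<lambda>n. exp (- \<delta>) * (\<delta> ^ n /\<^sub>R fact n)) sums (exp (- \<delta>) * exp \<delta>)"
      by (intro sums_mult exp_converges)
    then have "poisson_weight \<delta> sums 1"
      by (simp add: poisson_weight_def[abs_def] field_simps exp_minus)
    from suminf_ennreal_eq[OF poisson_weight_nonneg[OF assms(1)] this] show ?thesis by simp
  qed
  finally have "finite_measure (noncentral_gamma \<delta> a)"
    by (intro finite_measureI) simp
  then show ?thesis by (rule finite_measure.axioms)
qed

text \<open>The density factors over real and imaginary part, each contributing shape 1/2;
  convolution gives shape 1 and noncentrality (Re v)^2 + (Im v)^2.\<close>

lemma nn_integral_cscg_norm_square:
  assumes f[measurable]: "f \<in> borel_measurable borel"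
  shows "(\<integral>\<^sup>+z. f ((cmod (z + v))\<^sup>2) \<partial>cscg_measure) = (\<integral>\<^sup>+r. f r \<partial>noncentral_gamma ((cmod v)\<^sup>2) 1)"
proof -
  let ?e = "\<lambda>x. ennreal (exp (- x\<^sup>2) / sqrt pi)"
  have [measurable]: "(\<lambda>(x, y). Complex x y) \<in> borel_measurable (borel \<Otimes>\<^sub>M borel)"
    unfolding borel_measurable_complex_iff by (simp add: case_prod_unfold)
  have "(\<integral>\<^sup>+z. f ((cmod (z + v))\<^sup>2) \<partial>cscg_measure)
     = (\<integral>\<^sup>+z. ennreal (cscg_density z) * f ((cmod (z + v))\<^sup>2) \<partial>lborel)"
    unfolding cscg_measure_def by (subst nn_integral_density) auto
  also have "\<dots> = (\<integral>\<^sup>+p. ennreal (cscg_density (Complex (fst p) (snd p))) * f ((cmod (Complex (fst p) (snd p) + v))\<^sup>2) \<partial>(lborel \<Otimes>\<^sub>M lborel))"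
    by (subst lborel_complex, subst nn_integral_distr) (auto simp: case_prod_unfold)
  also have "\<dots> = (\<integral>\<^sup>+x. (\<integral>\<^sup>+y. ennreal (cscg_density (Complex x y)) * f ((cmod (Complex x y + v))\<^sup>2) \<partial>lborel) \<partial>lborel)"
    by (subst lborel.nn_integral_fst[symmetric]) (auto simp: case_prod_unfold)
  also have "\<dots> = (\<integral>\<^sup>+x. (\<integral>\<^sup>+y. ?e x * (?e y * f ((x + Re v)\<^sup>2 + (y + Im v)\<^sup>2)) \<partial>lborel) \<partial>lborel)"
  proof (intro nn_integral_cong)
    fix x y :: real
    have "cscg_density (Complex x y) = (exp (- x\<^sup>2) / sqrt pi) * (exp (- y\<^sup>2) / sqrt pi)"
      by (simp add: cscg_density_def cmod_def exp_add[symmetric] exp_diff exp_minus field_simps)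
    moreover have "(cmod (Complex x y + v))\<^sup>2 = (x + Re v)\<^sup>2 + (y + Im v)\<^sup>2"
      by (simp add: cmod_def)
    moreover have "ennreal ((exp (- x\<^sup>2) / sqrt pi) * (exp (- y\<^sup>2) / sqrt pi)) = ?e x * ?e y"
      by (intro ennreal_mult) auto
    ultimately show "ennreal (cscg_density (Complex x y)) * f ((cmod (Complex x y + v))\<^sup>2) = ?e x * (?e y * f ((x + Re v)\<^sup>2 + (y + Im v)\<^sup>2))"
      by (simp only: mult.assoc)
  qed
  also have "\<dots> = (\<integral>\<^sup>+x. ?e x * (\<integral>\<^sup>+y. ?e y * f ((x + Re v)\<^sup>2 + (y + Im v)\<^sup>2) \<partial>lborel) \<partial>lborel)"
    by (subst nn_integral_cmult) auto
  also have "\<dots> = (\<integral>\<^sup>+x. ?e x * (\<integral>\<^sup>+r. f ((x + Re v)\<^sup>2 + r) \<partial>noncentral_gamma ((Im v)\<^sup>2) (1 / 2)) \<partial>lborel)"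
    by (subst nn_integral_gauss_square) auto
  also have "\<dots> = (\<integral>\<^sup>+q. (\<integral>\<^sup>+r. f (q + r) \<partial>noncentral_gamma ((Im v)\<^sup>2) (1 / 2)) \<partial>noncentral_gamma ((Re v)\<^sup>2) (1 / 2))"
  proof -
    interpret sigma_finite_measure "noncentral_gamma ((Im v)\<^sup>2) (1 / 2)"
      by (rule noncentral_gamma_sigma_finite) auto
    show ?thesis by (subst nn_integral_gauss_square[symmetric]) auto
  qed
  also have "\<dots> = (\<integral>\<^sup>+r. f r \<partial>noncentral_gamma ((cmod v)\<^sup>2) 1)"
    by (subst nn_integral_noncentral_gamma_convolution) (auto simp: cmod_power2)
  finally show ?thesis .
qed

lemma prob_space_cscg_measure: "prob_space cscg_measure"
proof
  have "emeasure cscg_measure (space cscg_measure) = (\<integral>\<^sup>+r. 1 \<partial>noncentral_gamma 0 1)"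
    using nn_integral_cscg_norm_square[of "\<lambda>_. 1" 0] by simp
  also have "\<dots> = (\<Sum>n. ennreal (poisson_weight 0 n))"
    using prob_space.emeasure_space_1[OF prob_space_gamma_measure[of "1 + real _" 1]]
    by (subst nn_integral_noncentral_gamma) auto
  also have "\<dots> = 1"
    by (subst suminf_finite[where N = "{0}"]) (auto simp: poisson_weight_def)
  finally show "emeasure cscg_measure (space cscg_measure) = 1" .
qed

text \<open>Each coordinate adds one convolution with shape 1. The shift survives only through its
  squared norm, which is what reduces theta_0 to U later.\<close>

lemma nn_integral_PiM_cscg_norm_square:
  assumes "finite I" "I \<noteq> {}" and f: "f \<in> borel_measurable borel"
  shows "(\<integral>\<^sup>+z. f (\<Sum>l\<in>I. (cmod (z l + v l))\<^sup>2) \<partial>PiM I (\<lambda>_. cscg_measure))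
       = (\<integral>\<^sup>+r. f r \<partial>noncentral_gamma (\<Sum>l\<in>I. (cmod (v l))\<^sup>2) (real (card I)))"
  using assms
proof (induction I arbitrary: f rule: finite_ne_induct)
  case (singleton i)
  interpret prob_space cscg_measure by (rule prob_space_cscg_measure)
  interpret product_sigma_finite "\<lambda>_. cscg_measure" by unfold_locales
  note [measurable] = \<open>f \<in> borel_measurable borel\<close>
  show ?case
    using product_nn_integral_singleton[of "\<lambda>z. f ((cmod (z + v i))\<^sup>2)" i]
    by (simp add: nn_integral_cscg_norm_square)
next
  case (insert i I)
  interpret prob_space cscg_measure by (rule prob_space_cscg_measure)
  interpret product_sigma_finite "\<lambda>_. cscg_measure" by unfold_locales
  note [measurable] = \<open>f \<in> borel_measurable borel\<close>
  let ?N = "noncentral_gamma (\<Sum>l\<in>I. (cmod (v l))\<^sup>2) (real (card I))"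
  have c: "real (card I) > 0" using insert by (simp add: card_gt_0_iff)
  interpret N: sigma_finite_measure ?N
    using c by (intro noncentral_gamma_sigma_finite) (auto intro: sum_nonneg)
  have "(\<integral>\<^sup>+z. f (\<Sum>l\<in>insert i I. (cmod (z l + v l))\<^sup>2) \<partial>PiM (insert i I) (\<lambda>_. cscg_measure))
     = (\<integral>\<^sup>+y. (\<integral>\<^sup>+z. f (\<Sum>l\<in>insert i I. (cmod ((z(i := y)) l + v l))\<^sup>2) \<partial>PiM I (\<lambda>_. cscg_measure)) \<partial>cscg_measure)"
    using insert by (subst product_nn_integral_insert_rev) auto
  also have "\<dots> = (\<integral>\<^sup>+y. (\<integral>\<^sup>+z. f ((cmod (y + v i))\<^sup>2 + (\<Sum>l\<in>I. (cmod (z l + v l))\<^sup>2)) \<partial>PiM I (\<lambda>_. cscg_measure)) \<partial>cscg_measure)"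
  proof -
    have "(\<Sum>l\<in>insert i I. (cmod ((z(i := y)) l + v l))\<^sup>2) = (cmod (y + v i))\<^sup>2 + (\<Sum>l\<in>I. (cmod (z l + v l))\<^sup>2)" for y z
    proof -
      have "(\<Sum>l\<in>I. (cmod ((z(i := y)) l + v l))\<^sup>2) = (\<Sum>l\<in>I. (cmod (z l + v l))\<^sup>2)"
        using insert.hyps by (intro sum.cong) auto
      then show ?thesis using insert.hyps by simp
    qed
    then show ?thesis by (simp only:)
  qed
  also have "\<dots> = (\<integral>\<^sup>+y. (\<integral>\<^sup>+r. f ((cmod (y + v i))\<^sup>2 + r) \<partial>?N) \<partial>cscg_measure)"
    by (subst insert.IH[symmetric]) auto
  also have "\<dots> = (\<integral>\<^sup>+q. (\<integral>\<^sup>+r. f (q + r) \<partial>?N) \<partial>noncentral_gamma ((cmod (v i))\<^sup>2) 1)"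
    by (subst nn_integral_cscg_norm_square[symmetric]) auto
  also have "\<dots> = (\<integral>\<^sup>+r. f r \<partial>noncentral_gamma (\<Sum>l\<in>insert i I. (cmod (v l))\<^sup>2) (real (card (insert i I))))"
    using insert.hyps c by (subst nn_integral_noncentral_gamma_convolution) (auto intro: sum_nonneg)
  finally show ?case .
qed

section \<open>The mixture representation\<close>

text \<open>Infinite distributivity, read as the product integral formula for counting measures on a
  finite power of the naturals.\<close>

lemma prod_suminf_ennreal:
  fixes f :: "'k \<Rightarrow> nat \<Rightarrow> ennreal"
  assumes I: "finite I"
  shows "(\<Prod>k\<in>I. \<Sum>n. f k n) = (\<integral>\<^sup>+ell. (\<Prod>k\<in>I. f k (ell k)) \<partial>count_space {ell. \<forall>k. k \<notin> I \<longrightarrow> ell k = 0})"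
proof -
  interpret product_sigma_finite "\<lambda>_::'k. count_space (UNIV :: nat set)"
    by (intro product_sigma_finite.intro sigma_finite_measure_count_space_countable) auto
  \<comment> \<open>\<open>PiM\<close> works with functions that are \<open>undefined\<close>
    outside I, whereas the multi-indices of the theorem are 0 there.\<close>
  have bij: "bij_betw (\<lambda>ell. restrict ell I) {ell. \<forall>k. k \<notin> I \<longrightarrow> ell k = (0::nat)} (I \<rightarrow>\<^sub>E UNIV)"
    by (rule bij_betw_byWitness[where f' = "\<lambda>ell k. if k \<in> I then ell k else 0"])
       (auto simp: fun_eq_iff PiE_def extensional_def)
  have "(\<Prod>k\<in>I. \<Sum>n. f k n) = (\<Prod>k\<in>I. \<integral>\<^sup>+n. f k n \<partial>count_space UNIV)"
    by (simp add: nn_integral_count_space_nat)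
  also have "\<dots> = (\<integral>\<^sup>+ell. (\<Prod>k\<in>I. f k (ell k)) \<partial>PiM I (\<lambda>_. count_space UNIV))"
    using I by (intro product_nn_integral_prod[symmetric]) auto
  also have "PiM I (\<lambda>_. count_space UNIV) = count_space (I \<rightarrow>\<^sub>E (UNIV :: nat set))"
    using I by (intro count_space_PiM_finite) auto
  also have "(\<integral>\<^sup>+ell. (\<Prod>k\<in>I. f k (ell k)) \<partial>count_space (I \<rightarrow>\<^sub>E UNIV))
      = (\<integral>\<^sup>+ell. (\<Prod>k\<in>I. f k (restrict ell I k)) \<partial>count_space {ell. \<forall>k. k \<notin> I \<longrightarrow> ell k = 0})"
    by (rule nn_integral_bij_count_space[OF bij, symmetric])
  also have "\<dots> = (\<integral>\<^sup>+ell. (\<Prod>k\<in>I. f k (ell k)) \<partial>count_space {ell. \<forall>k. k \<notin> I \<longrightarrow> ell k = 0})"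
    by (intro nn_integral_cong prod.cong) auto
  finally show ?thesis .
qed

lemma countable_finite_support:
  assumes "finite I"
  shows "countable {ell :: 'k \<Rightarrow> nat. \<forall>k. k \<notin> I \<longrightarrow> ell k = 0}"
proof -
  have "inj_on (\<lambda>ell. restrict ell I) {ell :: 'k \<Rightarrow> nat. \<forall>k. k \<notin> I \<longrightarrow> ell k = 0}"
    by (rule inj_on_inverseI[where g = "\<lambda>ell k. if k \<in> I then ell k else 0"]) auto
  moreover have "countable ((\<lambda>ell. restrict ell I) ` {ell :: 'k \<Rightarrow> nat. \<forall>k. k \<notin> I \<longrightarrow> ell k = 0})"
    by (rule countable_subset[OF _ countable_PiE[OF assms, of "\<lambda>_. UNIV"]]) auto
  ultimately show ?thesis using countable_image_inj_on by blast
qed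

text \<open>Pointwise, Gamma density times Poisson weights is a constant times the density of shape
  a + sum \<open>ell\<close> and scale 1 / S, which integrates to 1. The constant is a negative
  multinomial weight; for a = m and \<rho>_k = mu_k^2 it is W.\<close>

lemma nn_integral_poisson_weights_gamma:
  fixes ell :: "'k \<Rightarrow> nat"
  assumes "finite I" and \<rho>: "\<And>k. k \<in> I \<Longrightarrow> \<rho> k \<ge> 0" and a: "a > 0"
  defines "S \<equiv> 1 + (\<Sum>k\<in>I. \<rho> k)"
  shows "(\<integral>\<^sup>+r. ennreal (\<Prod>k\<in>I. poisson_weight (\<rho> k * r) (ell k)) \<partial>gamma_measure a 1)
       = ennreal (Gamma (a + real (\<Sum>k\<in>I. ell k)) / Gamma a * S powr (- a) * (\<Prod>k\<in>I. (\<rho> k / S) ^ ell k / fact (ell k)))"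
    (is "_ = ennreal ?C")
proof -
  let ?n = "\<Sum>k\<in>I. ell k"
  have S: "S > 0" using \<rho> by (simp add: S_def sum_nonneg add_pos_nonneg)
  have G: "Gamma a > 0" "Gamma (a + real ?n) > 0" using a by (auto intro!: Gamma_real_pos add_pos_nonneg simp del: of_nat_sum)
  have C: "?C \<ge> 0"
    using G S \<rho> by (intro mult_nonneg_nonneg prod_nonneg) (auto simp del: of_nat_sum)
  have eq: "gamma_density a 1 r * (\<Prod>k\<in>I. poisson_weight (\<rho> k * r) (ell k)) = ?C * gamma_density (a + real ?n) (1 / S) r" for r
  proof (cases "r > 0")
    case False
    then show ?thesis by (simp add: gamma_density_def)
  next
    case True
    \<comment> \<open>Writing \<rho>_k r = (S r) (\<rho>_k / S) separates the power of r from the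
      ratios w_k.\<close>
    have "(\<Prod>k\<in>I. poisson_weight (\<rho> k * r) (ell k))
        = (\<Prod>k\<in>I. exp (- (\<rho> k * r)) * (S * r) ^ ell k * ((\<rho> k / S) ^ ell k / fact (ell k)))"
      using S by (intro prod.cong) (auto simp: poisson_weight_def power_mult_distrib power_divide)
    also have "\<dots> = exp (- (\<Sum>k\<in>I. \<rho> k) * r) * (S * r) ^ ?n * (\<Prod>k\<in>I. (\<rho> k / S) ^ ell k / fact (ell k))"
    proof -
      have "exp (- (\<Sum>k\<in>I. \<rho> k) * r) = (\<Prod>k\<in>I. exp (- (\<rho> k * r)))"
        using exp_sum[OF assms(1), of "\<lambda>k. - (\<rho> k * r)"] by (simp add: sum_negf sum_distrib_right)
      then show ?thesis by (simp only: prod.distrib power_sum)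
    qed
    finally have 1: "(\<Prod>k\<in>I. poisson_weight (\<rho> k * r) (ell k))
        = exp (- (\<Sum>k\<in>I. \<rho> k) * r) * (S * r) ^ ?n * (\<Prod>k\<in>I. (\<rho> k / S) ^ ell k / fact (ell k))" .
    have 2: "exp (- r) * exp (- (\<Sum>k\<in>I. \<rho> k) * r) = exp (- r * S)"
      by (simp add: S_def algebra_simps flip: exp_add)
    have 3: "r powr (a + real ?n - 1) = r powr (a - 1) * r ^ ?n"
    proof -
      have "a + real ?n - 1 = (a - 1) + real ?n" by simp
      then show ?thesis using True by (simp only: powr_add powr_realpow)
    qed
    have 4: "(1 / S) powr (a + real ?n) = S powr (- a) / S ^ ?n"
      using S by (simp add: powr_add powr_realpow powr_divide powr_minus field_simps del: of_nat_sum)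
    define Q where "Q = (\<Prod>k\<in>I. (\<rho> k / S) ^ ell k / fact (ell k))"
    have "gamma_density a 1 r * (\<Prod>k\<in>I. poisson_weight (\<rho> k * r) (ell k))
       = r powr (a - 1) * (exp (- r) * exp (- (\<Sum>k\<in>I. \<rho> k) * r)) * (S * r) ^ ?n * Q / Gamma a"
      unfolding 1 using True by (simp add: gamma_density_def Q_def del: of_nat_sum)
    also have "\<dots> = ?C * gamma_density (a + real ?n) (1 / S) r"
      unfolding 2 Q_def[symmetric] using True S G
      by (simp add: gamma_density_def 3 4 power_mult_distrib del: of_nat_sum)
    finally show ?thesis .
  qed
  have "(\<integral>\<^sup>+r. ennreal (\<Prod>k\<in>I. poisson_weight (\<rho> k * r) (ell k)) \<partial>gamma_measure a 1)
     = (\<integral>\<^sup>+r. ennreal (gamma_density a 1 r) * ennreal (\<Prod>k\<in>I. poisson_weight (\<rho> k * r) (ell k)) \<partial>lborel)"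
    by (subst nn_integral_gamma_measure) (auto simp: poisson_weight_def)
  also have "\<dots> = (\<integral>\<^sup>+r. ennreal ?C * ennreal (gamma_density (a + real ?n) (1 / S) r) \<partial>lborel)"
    using a C by (simp add: gamma_density_nonneg eq flip: ennreal_mult' del: of_nat_sum)
  also have "\<dots> = ennreal ?C * (\<integral>\<^sup>+r. 1 \<partial>gamma_measure (a + real ?n) (1 / S))"
    by (subst nn_integral_gamma_measure, simp, subst nn_integral_cmult) (auto simp del: of_nat_sum)
  also have "\<dots> = ennreal ?C"
    using prob_space.emeasure_space_1[OF prob_space_gamma_measure[of "a + real ?n" "1 / S"]] a S
    by (simp add: add_pos_nonneg del: of_nat_sum)
  finally show ?thesis .
qed

text \<open>A finite integral of a nonnegative function for counting measure is absolute
  summability. This leads from the \<open>ennreal\<close> computations to the real series of the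
  theorem.\<close>

lemma has_sum_nn_integral_count_space:
  fixes f :: "'a \<Rightarrow> real"
  assumes "\<And>x. x \<in> A \<Longrightarrow> f x \<ge> 0" "v \<ge> 0" "(\<integral>\<^sup>+x. ennreal (f x) \<partial>count_space A) = ennreal v"
  shows "(f has_sum v) A"
proof -
  have "has_bochner_integral (count_space A) f v"
    using assms by (intro has_bochner_integral_nn_integral) (auto simp: AE_count_space)
  then have i: "Infinite_Set_Sum.abs_summable_on f A" and v: "infsetsum f A = v"
    by (auto simp: Infinite_Set_Sum.abs_summable_on_def infsetsum_def has_bochner_integral_iff)
  have "f summable_on A"
    using i abs_summable_equivalent abs_summable_summable by blast
  then show ?thesis
    using v infsetsum_infsum[OF i] by (metis has_sum_infsum)
qed

text \<open>The conditional law of one gamma_k: the shift v stands for mu_k theta_0 with theta_0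
  held fixed.\<close>

lemma nn_integral_block:
  assumes "finite J" "J \<noteq> {}" and \<Omega>: "\<Omega> > 0" and A: "A \<in> sets borel"
  shows "(\<integral>\<^sup>+z. indicator A (\<Omega> * (\<Sum>i\<in>J. (cmod (z i + v i))\<^sup>2)) \<partial>PiM J (\<lambda>_. cscg_measure))
     = (\<Sum>n. ennreal (poisson_weight (\<Sum>i\<in>J. (cmod (v i))\<^sup>2) n) * emeasure (gamma_measure (real (card J) + real n) \<Omega>) A)"
proof -
  note [measurable] = A
  have c: "real (card J) > 0" using assms by (simp add: card_gt_0_iff)
  have "(\<integral>\<^sup>+r. indicator A (\<Omega> * r) \<partial>gamma_measure (real (card J) + real n) 1) = emeasure (gamma_measure (real (card J) + real n) \<Omega>) A" for n
    using c \<Omega> A by (subst nn_integral_gamma_measure_scale[of "indicator A"]) auto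
  then show ?thesis
    using assms by (subst nn_integral_PiM_cscg_norm_square[where f = "\<lambda>r. indicator A (\<Omega> * r)"])
      (auto simp: nn_integral_noncentral_gamma)
qed

text \<open>With theta_0 fixed, the indicator of a box factors over k and each factor is a Poisson
  sum. Expanding the product of sums and integrating over U leaves one term for each
  multi-index.\<close>

lemma joint_gamma_boxes:
  fixes \<theta> :: "nat \<Rightarrow> nat \<Rightarrow> 'a \<Rightarrow> complex" and \<mu> \<Omega> :: "nat \<Rightarrow> real"
  assumes "prob_space M" and m: "m \<ge> 1"
    and ind: "prob_space.indep_vars M (\<lambda>_. borel) (\<lambda>kl. \<theta> (fst kl) (snd kl)) ({0..K} \<times> {1..m})"
    and dist: "\<And>k l. k \<in> {0..K} \<Longrightarrow> l \<in> {1..m} \<Longrightarrow> distributed M lborel (\<theta> k l) (\<lambda>z. ennreal (cscg_density z))"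
    and \<Omega>: "\<And>k. k \<in> {1..K} \<Longrightarrow> \<Omega> k > 0"
    and A: "\<And>k. k \<in> {1..K} \<Longrightarrow> A k \<in> sets borel"
  defines "S \<equiv> 1 + (\<Sum>k\<in>{1..K}. (\<mu> k)\<^sup>2)"
  shows "emeasure M {\<omega> \<in> space M. \<forall>k\<in>{1..K}. \<Omega> k * (\<Sum>l\<in>{1..m}. (cmod (\<theta> k l \<omega> + of_real (\<mu> k) * \<theta> 0 l \<omega>))\<^sup>2) \<in> A k}
    = (\<integral>\<^sup>+ell. ennreal (Gamma (real m + real (\<Sum>k\<in>{1..K}. ell k)) / Gamma (real m) * S powr (- real m)
            * (\<Prod>k\<in>{1..K}. ((\<mu> k)\<^sup>2 / S) ^ ell k / fact (ell k)))
          * (\<Prod>k\<in>{1..K}. emeasure (gamma_measure (real (m + ell k)) (\<Omega> k)) (A k))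
        \<partial>count_space {ell. \<forall>k. k \<notin> {1..K} \<longrightarrow> ell k = 0})"
proof -
  interpret prob_space M by fact
  \<comment> \<open>The variables are grouped into K + 1 disjoint blocks, one for each k including
    0, so that their independence passes to the block vectors \<open>Z k\<close>.\<close>
  define J where "J k = {k} \<times> {1..m}" for k :: nat
  define Z where "Z k \<omega> = (\<lambda>i\<in>J k. \<theta> (fst i) (snd i) \<omega>)" for k \<omega>
  define N where "N k = PiM (J k) (\<lambda>_::nat \<times> nat. cscg_measure)" for k
  \<comment> \<open>\<open>(0, snd i)\<close> pairs the l-th coordinate of block k with the l-th
    coordinate of block 0.\<close>
  define X where "X k z y = \<Omega> k * (\<Sum>i\<in>J k. (cmod (z i + of_real (\<mu> k) * y (0, snd i)))\<^sup>2)"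
    for k :: nat and z y :: "nat \<times> nat \<Rightarrow> complex"
  define U where "U y = (\<Sum>i\<in>J 0. (cmod (y i))\<^sup>2)" for y :: "nat \<times> nat \<Rightarrow> complex"
  have J: "finite (J k)" "J k \<noteq> {}" "card (J k) = m" for k
    using m by (auto simp: J_def)
  interpret C: prob_space cscg_measure by (rule prob_space_cscg_measure)
  interpret N: prob_space "N k" for k
    unfolding N_def by (intro prob_space_PiM prob_space_cscg_measure)
  interpret PN: product_sigma_finite N ..
  have \<theta>m: "random_variable borel (\<theta> k l)" if "k \<in> {0..K}" "l \<in> {1..m}" for k l
    using dist[OF that] by (auto simp: distributed_def)
  have \<theta>d: "distr M borel (\<theta> k l) = cscg_measure" if "k \<in> {0..K}" "l \<in> {1..m}" for k l
    using dist[OF that] by (simp add: distributed_def cscg_measure_def cong: distr_cong)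
  have Zm: "Z k \<in> measurable M (PiM (J k) (\<lambda>_. borel))" if "k \<in> {0..K}" for k
    unfolding Z_def using that by (intro measurable_restrict \<theta>m) (auto simp: J_def)
  have Zd: "distr M (PiM (J k) (\<lambda>_. borel)) (Z k) = N k" if k: "k \<in> {0..K}" for k
  proof -
    have "indep_vars (\<lambda>_. borel) (\<lambda>kl. \<theta> (fst kl) (snd kl)) (J k)"
      using k by (intro indep_vars_subset[OF ind]) (auto simp: J_def)
    then have "distr M (PiM (J k) (\<lambda>_. borel)) (Z k) = PiM (J k) (\<lambda>i. distr M borel (\<theta> (fst i) (snd i)))"
      unfolding Z_def[abs_def] using J k
      by (subst (asm) indep_vars_iff_distr_eq_PiM') (auto simp: J_def intro!: \<theta>m)
    also have "\<dots> = N k"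
      unfolding N_def using k by (intro PiM_cong) (auto simp: J_def \<theta>d)
    finally show ?thesis .
  qed
  have law: "distr M (PiM {0..K} (\<lambda>k. PiM (J k) (\<lambda>_. borel))) (\<lambda>\<omega>. \<lambda>k\<in>{0..K}. Z k \<omega>) = PiM {0..K} N"
  proof -
    have "indep_vars (\<lambda>k. PiM (J k) (\<lambda>_. borel)) Z {0..K}"
      unfolding Z_def[abs_def]
      by (rule indep_vars_restrict[OF ind]) (auto simp: J_def disjoint_family_on_def)
    then have "distr M (PiM {0..K} (\<lambda>k. PiM (J k) (\<lambda>_. borel))) (\<lambda>\<omega>. \<lambda>k\<in>{0..K}. Z k \<omega>)
        = PiM {0..K} (\<lambda>k. distr M (PiM (J k) (\<lambda>_. borel)) (Z k))"
      by (subst (asm) indep_vars_iff_distr_eq_PiM') (auto intro!: Zm)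
    also have "\<dots> = PiM {0..K} N"
      by (intro PiM_cong Zd) auto
    finally show ?thesis .
  qed
  have sN [measurable_cong]: "sets (N k) = sets (PiM (J k) (\<lambda>_. borel))" for k
    unfolding N_def by (intro sets_PiM_cong) auto
  have sPN: "sets (PiM I N) = sets (PiM I (\<lambda>k. PiM (J k) (\<lambda>_. borel)))" for I
    by (intro sets_PiM_cong sN) auto
  have in0: "(0, snd i) \<in> J 0" if "i \<in> J k" for i k using that by (auto simp: J_def)
  have Xm: "(\<lambda>p. X k (fst p) (snd p)) \<in> borel_measurable (N k \<Otimes>\<^sub>M N 0)" for k
  proof -
    have [measurable]: "(\<lambda>z. z i) \<in> measurable (N k) borel" if "i \<in> J k" for i k
      unfolding measurable_cong_sets[OF sN refl] using that by measurable
    show ?thesis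
      unfolding X_def using in0 by measurable
  qed
  have Xm1: "(\<lambda>z. X k z y) \<in> borel_measurable (N k)" if "y \<in> space (N 0)" for k y
    using measurable_compose[OF measurable_Pair2'[OF that] Xm[of k]] by simp
  have Xm2: "(\<lambda>z. X k (z k) (z 0)) \<in> borel_measurable (PiM {0..K} N)" if "k \<in> {1..K}" for k
  proof -
    have "(\<lambda>z. (z k, z 0)) \<in> measurable (PiM {0..K} N) (N k \<Otimes>\<^sub>M N 0)"
      using that by (intro measurable_Pair measurable_component_singleton) auto
    from measurable_compose[OF this Xm[of k]] show ?thesis by simp
  qed
  have XZ: "X k (Z k \<omega>) (Z 0 \<omega>) = \<Omega> k * (\<Sum>l\<in>{1..m}. (cmod (\<theta> k l \<omega> + of_real (\<mu> k) * \<theta> 0 l \<omega>))\<^sup>2)" for k \<omega>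
  proof -
    have "(\<Sum>i\<in>J k. (cmod (Z k \<omega> i + of_real (\<mu> k) * Z 0 \<omega> (0, snd i)))\<^sup>2)
        = (\<Sum>i\<in>J k. (cmod (\<theta> (fst i) (snd i) \<omega> + of_real (\<mu> k) * \<theta> 0 (snd i) \<omega>))\<^sup>2)"
      by (intro sum.cong) (auto simp: Z_def J_def)
    also have "\<dots> = (\<Sum>l\<in>{1..m}. (cmod (\<theta> k l \<omega> + of_real (\<mu> k) * \<theta> 0 l \<omega>))\<^sup>2)"
      by (rule sum.reindex_bij_witness[where i = "Pair k" and j = snd]) (auto simp: J_def)
    finally show ?thesis by (simp add: X_def)
  qed
  let ?w = "\<lambda>r ell. ennreal (\<Prod>k\<in>{1..K}. poisson_weight ((\<mu> k)\<^sup>2 * r) (ell k))"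
  let ?g = "\<lambda>ell. (\<Prod>k\<in>{1..K}. emeasure (gamma_measure (real (m + ell k)) (\<Omega> k)) (A k))"
  let ?L = "{ell. \<forall>k. k \<notin> {1..K} \<longrightarrow> ell k = (0::nat)}"
  have L: "countable ?L" by (rule countable_finite_support) simp
  have "emeasure M {\<omega> \<in> space M. \<forall>k\<in>{1..K}. \<Omega> k * (\<Sum>l\<in>{1..m}. (cmod (\<theta> k l \<omega> + of_real (\<mu> k) * \<theta> 0 l \<omega>))\<^sup>2) \<in> A k}
     = (\<integral>\<^sup>+\<omega>. (\<Prod>k\<in>{1..K}. indicator (A k) (X k (Z k \<omega>) (Z 0 \<omega>))) \<partial>M)"
  proof (subst nn_integral_indicator[symmetric])
    have [measurable]: "\<theta> k l \<in> borel_measurable M" if "k \<in> {0..K}" "l \<in> {1..m}" for k l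
      by (rule \<theta>m[OF that])
    have h: "(\<lambda>\<omega>. \<Omega> k * (\<Sum>l\<in>{1..m}. (cmod (\<theta> k l \<omega> + of_real (\<mu> k) * \<theta> 0 l \<omega>))\<^sup>2)) \<in> borel_measurable M"
      if "k \<in> {1..K}" for k
      using that by (intro borel_measurable_times borel_measurable_sum borel_measurable_power borel_measurable_norm
        borel_measurable_add) (auto intro!: \<theta>m)
    have "{\<omega> \<in> space M. \<Omega> k * (\<Sum>l\<in>{1..m}. (cmod (\<theta> k l \<omega> + of_real (\<mu> k) * \<theta> 0 l \<omega>))\<^sup>2) \<in> A k} \<in> sets M"
      if "k \<in> {1..K}" for k
      using measurable_sets[OF h[OF that] A[OF that]] by (simp add: vimage_def Int_def conj_commute)
    then show "{\<omega> \<in> space M. \<forall>k\<in>{1..K}. \<Omega> k * (\<Sum>l\<in>{1..m}. (cmod (\<theta> k l \<omega> + of_real (\<mu> k) * \<theta> 0 l \<omega>))\<^sup>2) \<in> A k} \<in> sets M"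
      by (intro sets.sets_Collect_finite_All) auto
    show "(\<integral>\<^sup>+ \<omega>. indicator {\<omega> \<in> space M. \<forall>k\<in>{1..K}. \<Omega> k * (\<Sum>l\<in>{1..m}. (cmod (\<theta> k l \<omega> + of_real (\<mu> k) * \<theta> 0 l \<omega>))\<^sup>2) \<in> A k} \<omega> \<partial>M)
       = (\<integral>\<^sup>+\<omega>. (\<Prod>k\<in>{1..K}. indicator (A k) (X k (Z k \<omega>) (Z 0 \<omega>))) \<partial>M)"
      unfolding XZ by (intro nn_integral_cong) (auto simp: indicator_def prod.If_cases ball_def)
  qed
  also have "\<dots> = (\<integral>\<^sup>+z. (\<Prod>k\<in>{1..K}. indicator (A k) (X k (z k) (z 0))) \<partial>PiM {0..K} N)"
  proof (subst law[symmetric], subst nn_integral_distr)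
    show "(\<lambda>\<omega>. \<lambda>k\<in>{0..K}. Z k \<omega>) \<in> measurable M (PiM {0..K} (\<lambda>k. PiM (J k) (\<lambda>_. borel)))"
      by (intro measurable_restrict Zm)
    show "(\<lambda>z. \<Prod>k\<in>{1..K}. indicator (A k) (X k (z k) (z 0)) :: ennreal) \<in> borel_measurable
        (distr M (PiM {0..K} (\<lambda>k. PiM (J k) (\<lambda>_. borel))) (\<lambda>\<omega>. \<lambda>k\<in>{0..K}. Z k \<omega>))"
      unfolding law
      using A by (intro borel_measurable_prod_ennreal measurable_compose[OF Xm2] borel_measurable_indicator) auto
    show "(\<integral>\<^sup>+\<omega>. (\<Prod>k\<in>{1..K}. indicator (A k) (X k (Z k \<omega>) (Z 0 \<omega>))) \<partial>M)
       = (\<integral>\<^sup>+\<omega>. (\<Prod>k\<in>{1..K}. indicator (A k) (X k (restrict (\<lambda>k. Z k \<omega>) {0..K} k) (restrict (\<lambda>k. Z k \<omega>) {0..K} 0))) \<partial>M)"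
      by (intro nn_integral_cong prod.cong) auto
  qed
  \<comment> \<open>Splitting off coordinate 0 of the product measure plays the part of conditioning
    on theta_0.\<close>
  also have "\<dots> = (\<integral>\<^sup>+y. (\<integral>\<^sup>+z. (\<Prod>k\<in>{1..K}. indicator (A k) (X k (z k) y)) \<partial>PiM {1..K} N) \<partial>N 0)"
  proof -
    have ins: "{0..K} = insert 0 {1..K}" by auto
    have "(\<lambda>z. \<Prod>k\<in>{1..K}. indicator (A k) (X k (z k) (z 0)) :: ennreal) \<in> borel_measurable (PiM (insert 0 {1..K}) N)"
      unfolding ins[symmetric]
      using A by (intro borel_measurable_prod_ennreal measurable_compose[OF Xm2] borel_measurable_indicator) auto
    then have "(\<integral>\<^sup>+z. (\<Prod>k\<in>{1..K}. indicator (A k) (X k (z k) (z 0)) :: ennreal) \<partial>PiM {0..K} N)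
       = (\<integral>\<^sup>+y. (\<integral>\<^sup>+z. (\<Prod>k\<in>{1..K}. indicator (A k) (X k ((z(0 := y)) k) ((z(0 := y)) 0))) \<partial>PiM {1..K} N) \<partial>N 0)"
      unfolding ins by (intro PN.product_nn_integral_insert_rev) auto
    also have "\<dots> = (\<integral>\<^sup>+y. (\<integral>\<^sup>+z. (\<Prod>k\<in>{1..K}. indicator (A k) (X k (z k) y)) \<partial>PiM {1..K} N) \<partial>N 0)"
      by (intro nn_integral_cong prod.cong) auto
    finally show ?thesis .
  qed
  \<comment> \<open>For fixed y the k-th factor involves only the k-th block, so the integral of the
    product is a product of integrals.\<close>
  also have "\<dots> = (\<integral>\<^sup>+y. (\<Prod>k\<in>{1..K}. \<integral>\<^sup>+z. indicator (A k) (X k z y) \<partial>N k) \<partial>N 0)"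
    using A by (intro nn_integral_cong PN.product_nn_integral_prod
      measurable_compose[OF Xm1] borel_measurable_indicator) auto
  also have "\<dots> = (\<integral>\<^sup>+y. (\<Prod>k\<in>{1..K}. \<Sum>n. ennreal (poisson_weight ((\<mu> k)\<^sup>2 * U y) n)
        * emeasure (gamma_measure (real (m + n)) (\<Omega> k)) (A k)) \<partial>N 0)"
  proof (intro nn_integral_cong prod.cong refl)
    fix y :: "nat \<times> nat \<Rightarrow> complex" and k assume k: "k \<in> {1..K}"
    have "(\<Sum>i\<in>J k. (cmod (of_real (\<mu> k) * y (0, snd i)))\<^sup>2) = (\<mu> k)\<^sup>2 * (\<Sum>i\<in>J k. (cmod (y (0, snd i)))\<^sup>2)"
      by (simp add: norm_mult power_mult_distrib sum_distrib_left)
    also have "(\<Sum>i\<in>J k. (cmod (y (0, snd i)))\<^sup>2) = U y"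
      unfolding U_def
      by (rule sum.reindex_bij_witness[where i = "\<lambda>i. (k, snd i)" and j = "\<lambda>i. (0, snd i)"]) (auto simp: J_def)
    finally show "(\<integral>\<^sup>+z. indicator (A k) (X k z y) \<partial>N k) = (\<Sum>n. ennreal (poisson_weight ((\<mu> k)\<^sup>2 * U y) n)
        * emeasure (gamma_measure (real (m + n)) (\<Omega> k)) (A k))"
      unfolding X_def N_def using J \<Omega>[OF k] A[OF k] by (subst nn_integral_block) auto
  qed
  also have "\<dots> = (\<integral>\<^sup>+y. (\<integral>\<^sup>+ell. ?w (U y) ell * ?g ell \<partial>count_space ?L) \<partial>N 0)"
    by (subst prod_suminf_ennreal)
       (auto intro!: nn_integral_cong simp: prod.distrib U_def sum_nonneg poisson_weight_nonneg simp flip: prod_ennreal)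
  also have "\<dots> = (\<integral>\<^sup>+ell. (\<integral>\<^sup>+y. ?w (U y) ell * ?g ell \<partial>N 0) \<partial>count_space ?L)"
  proof (rule nn_integral_count_space_nn_integral[OF L])
    have [measurable]: "(\<lambda>z. z i) \<in> measurable (N k) borel" if "i \<in> J k" for i k
      unfolding measurable_cong_sets[OF sN refl] using that by measurable
    show "(\<lambda>y. ?w (U y) ell * ?g ell) \<in> borel_measurable (N 0)" for ell
      unfolding U_def poisson_weight_def by measurable
  qed
  also have "\<dots> = (\<integral>\<^sup>+ell. (\<integral>\<^sup>+r. ?w r ell \<partial>gamma_measure (real m) 1) * ?g ell \<partial>count_space ?L)"
  proof (rule nn_integral_cong)
    fix ell
    \<comment> \<open>U is a squared norm with zero shift, and \<open>poisson_weight 0\<close> is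
      concentrated at 0, so the mixture collapses to the Gamma law of shape m.\<close>
    have "(\<integral>\<^sup>+y. ?w (U y) ell * ?g ell \<partial>N 0) = (\<integral>\<^sup>+r. ?w r ell * ?g ell \<partial>noncentral_gamma 0 (real m))"
      using nn_integral_PiM_cscg_norm_square[OF J(1,2), of "\<lambda>r. ?w r ell * ?g ell" 0 "\<lambda>_. 0"] J(3)
      by (simp add: U_def N_def poisson_weight_def)
    also have "\<dots> = (\<integral>\<^sup>+r. ?w r ell * ?g ell \<partial>gamma_measure (real m) 1)"
      by (subst nn_integral_noncentral_gamma, simp add: poisson_weight_def,
          subst suminf_finite[where N = "{0}"]) (auto simp: poisson_weight_def)
    also have "\<dots> = (\<integral>\<^sup>+r. ?w r ell \<partial>gamma_measure (real m) 1) * ?g ell"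
      by (rule nn_integral_multc) (simp add: poisson_weight_def)
    finally show "(\<integral>\<^sup>+y. ?w (U y) ell * ?g ell \<partial>N 0) = (\<integral>\<^sup>+r. ?w r ell \<partial>gamma_measure (real m) 1) * ?g ell" .
  qed
  finally show ?thesis
    using m by (simp add: nn_integral_poisson_weights_gamma S_def del: of_nat_sum)
qed

text \<open>Boxes generate the product sigma-algebra and are stable under intersection, so agreement
  on boxes identifies the joint law. It can then be evaluated on the set where the product is at
  most x.\<close>

lemma cdf_prod_gamma_mixture:
  fixes \<theta> :: "nat \<Rightarrow> nat \<Rightarrow> 'a \<Rightarrow> complex" and \<mu> \<Omega> :: "nat \<Rightarrow> real"
  assumes "prob_space M" and m: "m \<ge> 1"
    and ind: "prob_space.indep_vars M (\<lambda>_. borel) (\<lambda>kl. \<theta> (fst kl) (snd kl)) ({0..K} \<times> {1..m})"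
    and dist: "\<And>k l. k \<in> {0..K} \<Longrightarrow> l \<in> {1..m} \<Longrightarrow> distributed M lborel (\<theta> k l) (\<lambda>z. ennreal (cscg_density z))"
    and \<Omega>: "\<And>k. k \<in> {1..K} \<Longrightarrow> \<Omega> k > 0"
  defines "S \<equiv> 1 + (\<Sum>k\<in>{1..K}. (\<mu> k)\<^sup>2)"
  shows "((\<lambda>ell. (Gamma (real m + real (\<Sum>k\<in>{1..K}. ell k)) / Gamma (real m) * S powr (- real m)
            * (\<Prod>k\<in>{1..K}. ((\<mu> k)\<^sup>2 / S) ^ ell k / fact (ell k)))
          * prod_gamma_cdf K (\<lambda>k. real (m + ell k)) \<Omega> x) has_sum
       measure M {\<omega> \<in> space M. (\<Prod>k\<in>{1..K}. 1 + \<Omega> k * (\<Sum>l\<in>{1..m}. (cmod (\<theta> k l \<omega> + of_real (\<mu> k) * \<theta> 0 l \<omega>))\<^sup>2)) \<le> x})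
     {ell. \<forall>k. k \<notin> {1..K} \<longrightarrow> ell k = 0}"
proof -
  interpret prob_space M by fact
  define X where "X k \<omega> = \<Omega> k * (\<Sum>l\<in>{1..m}. (cmod (\<theta> k l \<omega> + of_real (\<mu> k) * \<theta> 0 l \<omega>))\<^sup>2)" for k \<omega>
  define W where "W ell = Gamma (real m + real (\<Sum>k\<in>{1..K}. ell k)) / Gamma (real m) * S powr (- real m)
            * (\<Prod>k\<in>{1..K}. ((\<mu> k)\<^sup>2 / S) ^ ell k / fact (ell k))" for ell
  define L where "L = {ell :: nat \<Rightarrow> nat. \<forall>k. k \<notin> {1..K} \<longrightarrow> ell k = 0}"
  define P where "P ell = PiM {1..K} (\<lambda>k. gamma_measure (real (m + ell k)) (\<Omega> k))" for ell
  define D where "D = distr M (PiM {1..K} (\<lambda>_. borel)) (\<lambda>\<omega>. \<lambda>k\<in>{1..K}. X k \<omega>)"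
  \<comment> \<open>The mixture is realised as the monadic bind of this weighted counting measure
    with the kernel \<open>P\<close>.\<close>
  define W' where "W' = density (count_space L) (\<lambda>ell. ennreal (W ell))"
  have S: "S > 0" by (simp add: S_def sum_nonneg add_pos_nonneg)
  have W0: "W ell \<ge> 0" for ell
  proof -
    have "Gamma (real m + real (\<Sum>k\<in>{1..K}. ell k)) \<ge> 0" "Gamma (real m) \<ge> 0"
      using m by (auto intro!: Gamma_real_nonneg add_pos_nonneg simp del: of_nat_sum)
    then show ?thesis unfolding W_def using S
      by (intro mult_nonneg_nonneg divide_nonneg_nonneg prod_nonneg) (auto simp del: of_nat_sum)
  qed
  have P: "prob_space (P ell)" for ell
    unfolding P_def using m \<Omega>
    by (intro prob_space_PiM prob_space_gamma_measure) auto
  have sP [simp, measurable_cong]: "sets (P ell) = sets (PiM {1..K} (\<lambda>_. borel))" for ell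
    unfolding P_def by (intro sets_PiM_cong) auto
  have zL: "(\<lambda>_. 0) \<in> L" by (simp add: L_def)
  have Pm: "P \<in> measurable W' (subprob_algebra (PiM {1..K} (\<lambda>_. borel)))"
    unfolding W'_def
    by (auto simp: space_subprob_algebra intro!: prob_space_imp_subprob_space P cong: measurable_cong_sets)
  have emP: "emeasure (P ell) (Pi\<^sub>E {1..K} A) = (\<Prod>k\<in>{1..K}. emeasure (gamma_measure (real (m + ell k)) (\<Omega> k)) (A k))"
    if "\<And>k. k \<in> {1..K} \<Longrightarrow> A k \<in> sets borel" for A ell
  proof -
    \<comment> \<open>The product locale asks for a sigma-finite measure at every index; point
      masses fill the indices outside {1..K}, where \<open>\<Omega> k\<close> is
      unconstrained.\<close>
    define Q where "Q k = (if k \<in> {1..K} then gamma_measure (real (m + ell k)) (\<Omega> k) else return borel 0)" for k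
    interpret Q: prob_space "Q k" for k
      unfolding Q_def using m \<Omega> by (auto intro!: prob_space_gamma_measure prob_space_return)
    interpret Q: product_sigma_finite Q ..
    have "P ell = PiM {1..K} Q" unfolding P_def Q_def by (intro PiM_cong) auto
    moreover have "emeasure (PiM {1..K} Q) (Pi\<^sub>E {1..K} A) = (\<Prod>k\<in>{1..K}. emeasure (Q k) (A k))"
      using that by (intro Q.emeasure_PiM) (auto simp: Q_def)
    ultimately show ?thesis by (simp add: Q_def)
  qed
  have \<theta>m: "\<theta> k l \<in> borel_measurable M" if "k \<in> {0..K}" "l \<in> {1..m}" for k l
    using dist[OF that] by (auto simp: distributed_def)
  have Xm [measurable]: "X k \<in> borel_measurable M" if "k \<in> {1..K}" for k
  proof -
    have [measurable]: "\<theta> 0 l \<in> borel_measurable M" "\<theta> k l \<in> borel_measurable M" if "l \<in> {1..m}" for l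
      using \<theta>m \<open>k \<in> {1..K}\<close> that by auto
    show ?thesis unfolding X_def[abs_def] by measurable
  qed
  have em_bind: "emeasure (W' \<bind> P) B = (\<integral>\<^sup>+ell. ennreal (W ell) * emeasure (P ell) B \<partial>count_space L)"
    if "B \<in> sets (PiM {1..K} (\<lambda>_. borel))" for B
  proof -
    have "emeasure (W' \<bind> P) B = (\<integral>\<^sup>+ell. emeasure (P ell) B \<partial>W')"
      using zL by (intro emeasure_bind[OF _ Pm that]) (auto simp: W'_def)
    also have "\<dots> = (\<integral>\<^sup>+ell. ennreal (W ell) * emeasure (P ell) B \<partial>count_space L)"
      unfolding W'_def by (subst nn_integral_density) auto
    finally show ?thesis .
  qed
  have Dm: "(\<lambda>\<omega>. \<lambda>k\<in>{1..K}. X k \<omega>) \<in> measurable M (PiM {1..K} (\<lambda>_. borel))"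
    by (intro measurable_restrict Xm)
  interpret D: prob_space D unfolding D_def by (rule prob_space_distr[OF Dm])
  \<comment> \<open>the total mass of W' need not be computed: the boxes include the whole space\<close>
  have "D = W' \<bind> P"
  proof (rule measure_eqI_PiM_finite[where I = "{1..K}" and M = "\<lambda>_. borel" and A = "\<lambda>_. space (PiM {1..K} (\<lambda>_. borel))"])
    show "sets D = sets (PiM {1..K} (\<lambda>_. borel))" by (simp add: D_def)
    show "sets (W' \<bind> P) = sets (PiM {1..K} (\<lambda>_. borel))"
      using zL by (intro sets_bind[where N = "PiM {1..K} (\<lambda>_. borel)"] sP) (auto simp: W'_def)
    show "range (\<lambda>_::nat. space (PiM {1..K} (\<lambda>_. borel :: real measure))) \<subseteq> prod_algebra {1..K} (\<lambda>_. borel)"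
      by (auto simp: space_PiM intro!: prod_algebraI_finite)
    fix A :: "nat \<Rightarrow> real set" assume A: "\<And>k. k \<in> {1..K} \<Longrightarrow> A k \<in> sets borel"
    have B: "Pi\<^sub>E {1..K} A \<in> sets (PiM {1..K} (\<lambda>_. borel))"
      using A by (intro sets_PiM_I_finite) auto
    have "emeasure D (Pi\<^sub>E {1..K} A) = emeasure M {\<omega> \<in> space M. \<forall>k\<in>{1..K}. X k \<omega> \<in> A k}"
      unfolding D_def by (subst emeasure_distr[OF Dm B]) (auto intro!: arg_cong[where f = "emeasure M"] simp: Pi_iff)
    also have "\<dots> = emeasure (W' \<bind> P) (Pi\<^sub>E {1..K} A)"
    proof -
      have e: "emeasure (P ell) (Pi\<^sub>E {1..K} A) = (\<Prod>k\<in>{1..K}. emeasure (gamma_measure (real (m + ell k)) (\<Omega> k)) (A k))" for ell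
        by (rule emP) (rule A)
      show ?thesis
        unfolding X_def em_bind[OF B] e W_def L_def S_def
        by (rule joint_gamma_boxes[OF assms(1-5)]) (assumption | rule A)+
    qed
    finally show "emeasure D (Pi\<^sub>E {1..K} A) = emeasure (W' \<bind> P) (Pi\<^sub>E {1..K} A)" .
  qed auto
  define B where "B = {r \<in> space (PiM {1..K} (\<lambda>_. borel :: real measure)). (\<Prod>k\<in>{1..K}. 1 + r k) \<le> x}"
  have Bm: "B \<in> sets (PiM {1..K} (\<lambda>_. borel))" unfolding B_def by measurable
  have "emeasure M {\<omega> \<in> space M. (\<Prod>k\<in>{1..K}. 1 + X k \<omega>) \<le> x} = emeasure D B"
  proof -
    have "(\<Prod>k\<in>{1..K}. 1 + restrict (\<lambda>k. X k \<omega>) {1..K} k) = (\<Prod>k\<in>{1..K}. 1 + X k \<omega>)" for \<omega>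
      by (intro prod.cong) auto
    then have "{\<omega> \<in> space M. (\<Prod>k\<in>{1..K}. 1 + X k \<omega>) \<le> x} = (\<lambda>\<omega>. \<lambda>k\<in>{1..K}. X k \<omega>) -` B \<inter> space M"
      unfolding B_def vimage_def space_PiM by auto
    then show ?thesis
      unfolding D_def by (simp only: emeasure_distr[OF Dm Bm])
  qed
  also have "\<dots> = (\<integral>\<^sup>+ell. ennreal (W ell) * emeasure (P ell) B \<partial>count_space L)"
    unfolding \<open>D = W' \<bind> P\<close> by (rule em_bind[OF Bm])
  also have "\<dots> = (\<integral>\<^sup>+ell. ennreal (W ell * prod_gamma_cdf K (\<lambda>k. real (m + ell k)) \<Omega> x) \<partial>count_space L)"
  proof (intro nn_integral_cong)
    fix ell
    interpret P: prob_space "P ell" by (rule P)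
    have "prod_gamma_cdf K (\<lambda>k. real (m + ell k)) \<Omega> x = measure (P ell) B"
      unfolding prod_gamma_cdf_def Let_def P_def B_def gamma_measure_def by (simp add: space_PiM)
    then show "ennreal (W ell) * emeasure (P ell) B = ennreal (W ell * prod_gamma_cdf K (\<lambda>k. real (m + ell k)) \<Omega> x)"
      using W0 by (simp add: P.emeasure_eq_measure ennreal_mult')
  qed
  finally have "(\<integral>\<^sup>+ell. ennreal (W ell * prod_gamma_cdf K (\<lambda>k. real (m + ell k)) \<Omega> x) \<partial>count_space L)
      = ennreal (measure M {\<omega> \<in> space M. (\<Prod>k\<in>{1..K}. 1 + X k \<omega>) \<le> x})"
    by (simp add: emeasure_eq_measure)
  moreover have "W ell * prod_gamma_cdf K (\<lambda>k. real (m + ell k)) \<Omega> x \<ge> 0" for ell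
    using W0 by (simp add: prod_gamma_cdf_def Let_def)
  ultimately show ?thesis
    unfolding W_def[symmetric] L_def[symmetric] X_def[symmetric]
    by (intro has_sum_nn_integral_count_space) auto
qed

section \<open>Mellin inversion\<close>

text \<open>The quotient in Levy's formula is the Fourier transform of an interval. This yields both
  a bound uniform in t and the inner integral for Fubini.\<close>

lemma iexp_difference_quotient:
  assumes "t \<noteq> 0" "a \<le> b"
  shows "(iexp (- (t * a)) - iexp (- (t * b))) / (\<i> * t) = (CLBINT u. indicator {a..b} u *\<^sub>R iexp (- (t * u)))"
proof -
  have "(CLBINT u. indicator {a..b} u *\<^sub>R iexp (- (t * u))) = iexp (- (t * b)) / (- \<i> * t) - iexp (- (t * a)) / (- \<i> * t)"
  proof (rule integral_FTC_Icc[OF assms(2)])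
    fix x
    have "((\<lambda>u. exp (\<i> * (- (of_real t * of_real u))) / (- \<i> * t)) has_vector_derivative
        exp (\<i> * (- (of_real t * of_real x)))) (at x within {a..b})"
      using assms(1) by (auto intro!: derivative_eq_intros has_vector_derivative_real_field simp: field_simps)
    then show "((\<lambda>u. iexp (- (t * u)) / (- \<i> * t)) has_vector_derivative iexp (- (t * x))) (at x within {a..b})"
      by simp
  qed (auto intro!: continuous_intros)
  then show ?thesis by (simp add: diff_divide_distrib)
qed

text \<open>If g a were nonzero, g would stay within |g a| / 2 of it on a short interval to the
  right of a, and its integral there could not vanish.\<close>

lemma eq_zero_of_vanishing_integrals:
  fixes g :: "real \<Rightarrow> complex"
  assumes g: "\<And>b. a < b \<Longrightarrow> set_integrable lborel {a..b} g" and z: "\<And>b. a < b \<Longrightarrow> (CLBINT u:{a..b}. g u) = 0"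
    and c: "continuous (at_right a) g"
  shows "g a = 0"
proof (rule ccontr)
  assume "g a \<noteq> 0"
  define e where "e = norm (g a) / 2"
  have e: "e > 0" using \<open>g a \<noteq> 0\<close> by (simp add: e_def)
  have "\<forall>\<^sub>F u in at_right a. dist (g u) (g a) < e"
    using c e unfolding continuous_within by (rule tendstoD)
  then obtain b where b: "a < b" "\<And>u. a < u \<Longrightarrow> u < b \<Longrightarrow> dist (g u) (g a) < e"
    unfolding eventually_at_right_field by auto
  \<comment> \<open>The midpoint keeps the closed interval [a, m] inside [a, b), where the bound
    holds.\<close>
  define m where "m = (a + b) / 2"
  have m: "a < m" "m < b" using b(1) by (auto simp: m_def)
  have gi: "set_integrable lborel {a..m} g" using g[OF m(1)] .
  have ci: "set_integrable lborel {a..m} (\<lambda>_. g a)" by (intro borel_integrable_atLeastAtMost' continuous_intros)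
  have "(m - a) * norm (g a) = norm (CLBINT u:{a..m}. g a)"
    using m by (simp add: set_lebesgue_integral_def)
  also have "(CLBINT u:{a..m}. g a) = - (CLBINT u:{a..m}. g u - g a)"
    using set_integral_diff(2)[OF gi ci] z[OF m(1)] by simp
  also have "norm (- (CLBINT u:{a..m}. g u - g a)) \<le> (LBINT u:{a..m}. norm (g u - g a))"
    using set_integral_norm_bound[OF set_integral_diff(1)[OF gi ci]] by simp
  also have "\<dots> \<le> (LBINT u:{a..m}. e)"
  proof (rule set_integral_mono)
    show "set_integrable lborel {a..m} (\<lambda>u. norm (g u - g a))"
      by (rule set_integrable_norm[OF set_integral_diff(1)[OF gi ci]])
    fix u assume "u \<in> {a..m}"
    then show "norm (g u - g a) \<le> e"
      using b(2)[of u] m e by (cases "u = a") (auto simp: dist_norm)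
  qed (intro borel_integrable_atLeastAtMost' continuous_intros)
  also have "\<dots> = (m - a) * e" using m by (simp add: set_lebesgue_integral_def)
  finally have "norm (g a) \<le> e" using m by simp
  then show False using \<open>g a \<noteq> 0\<close> by (simp add: e_def)
qed

text \<open>Levy's inversion formula identifies the integrals of h and of its inverse Fourier
  transform over all intervals; right continuity of h makes this pointwise.\<close>

lemma fourier_inversion:
  fixes h :: "real \<Rightarrow> real"
  defines "H \<equiv> \<lambda>y. CLBINT u. complex_of_real (h u) * iexp (y * u)"
  assumes hi: "integrable lborel h" and h0: "\<And>u. h u \<ge> 0" and pos: "(LBINT u. h u) > 0"
    and Hi: "integrable lborel H" and rc: "continuous (at_right a) h"
  shows "complex_of_real (h a) = 1 / (2 * pi) * (CLBINT y. H y * iexp (- (y * a)))"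
proof -
  note hm [measurable] = borel_measurable_integrable[OF hi, simplified]
  define C where "C = (LBINT u. h u)"
  have C: "C > 0" using pos by (simp add: C_def)
  \<comment> \<open>Levy's formula concerns probability laws, so h is normalised by its total mass;
    the characteristic function is then H / C.\<close>
  define N where "N = density lborel (\<lambda>u. ennreal (h u / C))"
  have sN [simp, measurable_cong]: "sets N = sets borel" by (simp add: N_def)
  have "(\<integral>\<^sup>+u. ennreal (h u / C) \<partial>lborel) = ennreal (LBINT u. h u / C)"
    using h0 C hi by (intro nn_integral_eq_integral) auto
  also have "\<dots> = 1" using C by (simp add: C_def)
  finally have "prob_space N"
    by (intro prob_spaceI) (simp add: N_def emeasure_density)
  interpret N: real_distribution N
    by (intro real_distribution.intro real_distribution_axioms.intro \<open>prob_space N\<close>) (simp_all add: N_def)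
  have ch: "char N t = H t / C" for t
  proof -
    have "char N t = (CLBINT u. (h u / C) *\<^sub>R iexp (t * u))"
      unfolding char_def N_def using h0 C by (subst integral_density) auto
    also have "\<dots> = (CLBINT u. (complex_of_real (h u) * iexp (t * u)) / C)"
      by (intro Bochner_Integration.integral_cong) (auto simp: scaleR_conv_of_real)
    finally show ?thesis by (simp add: H_def)
  qed
  note Hm [measurable] = borel_measurable_integrable[OF Hi, simplified]
  \<comment> \<open>The candidate for h. Since H is integrable, dominated convergence makes k
    continuous.\<close>
  define k where "k u = 1 / (2 * pi) * (CLBINT t. H t * iexp (- (t * u)))" for u
  have kt: "(\<lambda>n. k (v n)) \<longlonglongrightarrow> k u" if "v \<longlonglongrightarrow> u" for v u
    unfolding k_def
  proof (intro tendsto_intros integral_dominated_convergence[where w = "\<lambda>t. norm (H t)"])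
    show "AE t in lborel. (\<lambda>n. H t * iexp (- (t * v n))) \<longlonglongrightarrow> H t * iexp (- (t * u))"
      using that by (intro AE_I2 tendsto_intros) auto
    show "integrable lborel (\<lambda>t. norm (H t))" using Hi by simp
  qed (auto simp: norm_mult)
  have kc: "isCont k u" for u
    using kt by (auto simp: continuous_at_sequentially o_def)
  then have km [measurable]: "k \<in> borel_measurable borel"
    by (intro borel_measurable_continuous_onI continuous_at_imp_continuous_on) auto
  have ki: "set_integrable lborel {a..b} k" for b
    using kc by (intro borel_integrable_atLeastAtMost' continuous_at_imp_continuous_on) auto
  have hi': "set_integrable lborel {a..b} (\<lambda>u. complex_of_real (h u))" for b
    unfolding set_integrable_def using hi
    by (intro integrable_mult_indicator) auto
  have eq: "(CLBINT u:{a..b}. complex_of_real (h u)) = (CLBINT u:{a..b}. k u)" if ab: "a < b" for b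
  proof -
    let ?q = "\<lambda>t. (iexp (- (t * a)) - iexp (- (t * b))) / (\<i> * t)"
    \<comment> \<open>At t = 0 division by zero gives the value 0, which also satisfies the
      bound.\<close>
    have qb: "norm (?q t) \<le> b - a" for t
    proof (cases "t = 0")
      case False
      then have "?q t = (CLBINT u. indicator {a..b} u *\<^sub>R iexp (- (t * u)))"
        using ab by (intro iexp_difference_quotient) auto
      also have "norm \<dots> \<le> (LBINT u. norm (indicator {a..b} u *\<^sub>R iexp (- (t * u))))"
        by (rule integral_norm_bound)
      also have "\<dots> = (LBINT u. indicator {a..b} u)"
        by (intro Bochner_Integration.integral_cong) auto
      finally show ?thesis using ab by simp
    qed (use ab in auto)
    \<comment> \<open>A law with a density has no atoms, so every a and b is admissible in Levy's
      formula.\<close>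
    have sing: "measure N {x} = 0" for x
    proof -
      have "emeasure N {x} = 0"
        unfolding N_def by (subst emeasure_density, simp, simp)
          (intro nn_integral_0_iff_AE[THEN iffD2] eventually_mono[OF AE_lborel_singleton[of x]], auto split: split_indicator)
      then show ?thesis by (simp add: measure_def)
    qed
    have "(\<lambda>T::nat. 1 / (2 * pi) * (CLBINT t=- real T..real T. ?q t * char N t)) \<longlonglongrightarrow> measure N {a<..b}"
      using N.Levy_Inversion[OF less_imp_le[OF ab] sing sing] by (simp only: uminus_ereal.simps of_real_divide of_real_mult of_real_1 of_real_numeral of_int_minus of_int_of_nat_eq)
    moreover have "(\<lambda>T::nat. 1 / (2 * pi) * (CLBINT t=- real T..real T. ?q t * char N t))
        \<longlonglongrightarrow> 1 / (2 * pi) * (CLBINT t. ?q t * (H t / C))"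
    \<comment> \<open>The quotient is bounded by b - a and H is integrable, so the truncated
      integrals converge to an absolutely convergent one.\<close>
    proof (intro tendsto_intros)
      have "(\<lambda>T::nat. CLBINT t. indicator {- real T<..<real T} t *\<^sub>R (?q t * (H t / C))) \<longlonglongrightarrow> (CLBINT t. ?q t * (H t / C))"
      proof (rule integral_dominated_convergence[where w = "\<lambda>t. (b - a) * norm (H t / C)"])
        show "integrable lborel (\<lambda>t. (b - a) * norm (H t / C))" using Hi by simp
        show "AE t in lborel. (\<lambda>T. indicator {- real T<..<real T} t *\<^sub>R (?q t * (H t / C))) \<longlonglongrightarrow> ?q t * (H t / C)"
        proof (rule AE_I2)
          fix t :: real
          obtain n where n: "\<bar>t\<bar> < real n" using reals_Archimedean2 by blast
          have "\<forall>\<^sub>F T in sequentially. indicator {- real T<..<real T} t *\<^sub>R (?q t * (H t / C)) = ?q t * (H t / C)"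
            using eventually_ge_at_top[of n]
          proof eventually_elim
            case (elim T)
            then have "real n \<le> real T" by simp
            then have "t \<in> {- real T<..<real T}" using n by auto
            then show ?case by simp
          qed
          then show "(\<lambda>T. indicator {- real T<..<real T} t *\<^sub>R (?q t * (H t / C))) \<longlonglongrightarrow> ?q t * (H t / C)"
            by (rule tendsto_eventually)
        qed
        show "AE t in lborel. norm (indicator {- real T<..<real T} t *\<^sub>R (?q t * (H t / C))) \<le> (b - a) * norm (H t / C)" for T
        proof (rule AE_I2)
          fix t
          have "norm (indicator {- real T<..<real T} t *\<^sub>R (?q t * (H t / C))) \<le> norm (?q t * (H t / C))"
            by (auto split: split_indicator)
          also have "\<dots> \<le> (b - a) * norm (H t / C)"
            unfolding norm_mult by (intro mult_right_mono qb norm_ge_zero)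
          finally show "norm (indicator {- real T<..<real T} t *\<^sub>R (?q t * (H t / C))) \<le> (b - a) * norm (H t / C)" .
        qed
      qed measurable
      then show "(\<lambda>T::nat. CLBINT t=- real T..real T. ?q t * char N t) \<longlonglongrightarrow> (CLBINT t. ?q t * (H t / C))"
        by (simp add: interval_lebesgue_integral_def set_lebesgue_integral_def ch)
    qed
    ultimately have "complex_of_real (measure N {a<..b}) = 1 / (2 * pi) * (CLBINT t. ?q t * (H t / C))"
      by (rule LIMSEQ_unique)
    also have "(CLBINT t. ?q t * (H t / C)) = (CLBINT t. (CLBINT u. indicator {a..b} u *\<^sub>R (H t * iexp (- (t * u))) / C))"
    proof (rule integral_cong_AE)
      show "AE t in lborel. ?q t * (H t / C) = (CLBINT u. indicator {a..b} u *\<^sub>R (H t * iexp (- (t * u))) / C)"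
        using AE_lborel_singleton[of 0]
      proof eventually_elim
        case (elim t)
        have "?q t * (H t / C) = (CLBINT u. indicator {a..b} u *\<^sub>R iexp (- (t * u))) * (H t / C)"
          using elim ab by (subst iexp_difference_quotient) auto
        also have "\<dots> = (CLBINT u. indicator {a..b} u *\<^sub>R iexp (- (t * u)) * (H t / C))"
          by (rule integral_mult_left_zero[symmetric])
        also have "\<dots> = (CLBINT u. indicator {a..b} u *\<^sub>R (H t * iexp (- (t * u))) / C)"
          by (intro Bochner_Integration.integral_cong) (auto simp: scaleR_conv_of_real mult_ac)
        finally show ?case .
      qed
    qed measurable
    \<comment> \<open>With the quotient written as an integral over [a, b], Fubini exchanges t and
      u; the t-integral is then k u up to the factors 2 pi and C.\<close>
    also have "\<dots> = (CLBINT u. (CLBINT t. indicator {a..b} u *\<^sub>R (H t * iexp (- (t * u))) / C))"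
    proof (rule lborel_pair.Fubini_integral[symmetric], rule lborel_pair.Fubini_integrable)
      have "(LBINT u. norm (indicator {a..b} u *\<^sub>R (H t * iexp (- (t * u))) / C)) = (b - a) * norm (H t) / C" for t
      proof -
        have "(LBINT u. norm (indicator {a..b} u *\<^sub>R (H t * iexp (- (t * u))) / C)) = (LBINT u. indicator {a..b} u * (norm (H t) / C))"
          using C by (intro Bochner_Integration.integral_cong) (auto simp: norm_mult norm_divide)
        then show ?thesis using ab by simp
      qed
      then show "integrable lborel (\<lambda>t. LBINT u. norm (case (t, u) of (t, u) \<Rightarrow> indicator {a..b} u *\<^sub>R (H t * iexp (- (t * u))) / C))"
        using Hi by simp
      show "AE t in lborel. integrable lborel (\<lambda>u. case (t, u) of (t, u) \<Rightarrow> indicator {a..b} u *\<^sub>R (H t * iexp (- (t * u))) / C)"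
      proof (rule AE_I2)
        fix t
        have "set_integrable lborel {a..b} (\<lambda>u. H t * iexp (- (t * u)))"
          by (intro borel_integrable_atLeastAtMost' continuous_intros)
        then show "integrable lborel (\<lambda>u. case (t, u) of (t, u) \<Rightarrow> indicator {a..b} u *\<^sub>R (H t * iexp (- (t * u))) / C)"
          by (auto simp: set_integrable_def)
      qed
    qed measurable
    finally have "complex_of_real (measure N {a<..b})
        = (CLBINT u. 1 / (2 * pi) * (CLBINT t. indicator {a..b} u *\<^sub>R (H t * iexp (- (t * u))) / C))"
      by (simp only: integral_mult_right_zero)
    also have "\<dots> = (CLBINT u. (indicator {a..b} u *\<^sub>R k u) / C)"
      by (intro Bochner_Integration.integral_cong) (auto simp: k_def scaleR_conv_of_real)
    also have "\<dots> = (CLBINT u:{a..b}. k u) / C"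
      by (simp add: set_lebesgue_integral_def)
    finally have A: "(CLBINT u:{a..b}. k u) = C * complex_of_real (measure N {a<..b})"
      using C by simp
    have "emeasure N {a<..b} = (\<integral>\<^sup>+u. ennreal (indicator {a..b} u * (h u / C)) \<partial>lborel)"
      unfolding N_def
      by (subst emeasure_density, simp, simp)
         (intro nn_integral_cong_AE eventually_mono[OF AE_lborel_singleton[of a]], auto split: split_indicator)
    also have "\<dots> = ennreal (LBINT u. indicator {a..b} u * (h u / C))"
      using h0 C integrable_real_mult_indicator[OF _ hi, of "{a..b}"]
      by (intro nn_integral_eq_integral) (auto simp: mult.commute[of "indicator _ _"])
    finally have "measure N {a<..b} = (LBINT u. indicator {a..b} u * (h u / C))"
      using h0 C by (simp add: measure_def integral_nonneg_AE)
    then have "C * measure N {a<..b} = (LBINT u:{a..b}. h u)"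
      using C by (simp add: set_lebesgue_integral_def)
    then show ?thesis
      unfolding A by (simp add: set_integral_complex_of_real flip: of_real_mult)
  qed
  have "complex_of_real (h a) - k a = 0"
  proof (rule eq_zero_of_vanishing_integrals)
    show "set_integrable lborel {a..b} (\<lambda>u. complex_of_real (h u) - k u)" for b
      by (intro set_integral_diff hi' ki)
    show "(CLBINT u:{a..b}. complex_of_real (h u) - k u) = 0" if "a < b" for b
      using set_integral_diff(2)[OF hi' ki] eq[OF that] by simp
    have "continuous (at_right a) k" using kc[of a] by (rule continuous_at_imp_continuous_at_within)
    then show "continuous (at_right a) (\<lambda>u. complex_of_real (h u) - k u)"
      using rc by (intro continuous_intros)
  qed
  then show ?thesis by (simp add: k_def)
qed

section \<open>Mellin transforms of distribution functions\<close>

text \<open>The three facts that Fubini needs for the kernel 1[v <= u] exp (s u): integrability in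
  u, its value, and the integral of its norm. The real exponential, handled first, dominates the
  complex one.\<close>

lemma exp_half_line:
  fixes s :: complex
  assumes s: "Re s < 0"
  shows "integrable lborel (\<lambda>u. if v \<le> u then exp (s * of_real u) else 0)"
    and "(CLBINT u. (if v \<le> u then exp (s * of_real u) else 0)) = - exp (s * of_real v) / s"
    and "(LBINT u. norm (if v \<le> u then exp (s * of_real u) else 0)) = exp (Re s * v) / (- Re s)"
proof -
  let ?f = "\<lambda>u::real. exp (s * of_real u)"
  let ?F = "\<lambda>u. exp (s * of_real u) / s"
  have s0: "s \<noteq> 0" using s by auto
  have lim: "((\<lambda>u. exp (Re s * u)) \<longlongrightarrow> 0) at_top"
    using s by (intro filterlim_compose[OF exp_at_bot] filterlim_tendsto_neg_mult_at_bot[OF tendsto_const])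
      (auto simp: filterlim_ident)
  have R: "set_integrable lborel (einterval v \<infinity>) (\<lambda>u. exp (Re s * u))"
    "(LBINT u=v..\<infinity>. exp (Re s * u)) = 0 - exp (Re s * v) / Re s"
  proof -
    let ?G = "\<lambda>u. exp (Re s * u) / Re s"
    have F: "DERIV ?G u :> exp (Re s * u)" for u
      using s by (auto intro!: derivative_eq_intros)
    have A: "((?G \<circ> real_of_ereal) \<longlongrightarrow> ?G v) (at_right (ereal v))"
      using s by (auto simp: ereal_tendsto_simps intro!: tendsto_eq_intros)
    have B: "((?G \<circ> real_of_ereal) \<longlongrightarrow> 0) (at_left \<infinity>)"
      using tendsto_divide[OF lim tendsto_const, of "Re s"] s by (simp add: ereal_tendsto_simps)
    show "set_integrable lborel (einterval v \<infinity>) (\<lambda>u. exp (Re s * u))"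
      by (rule interval_integral_FTC_nonneg(1)[OF _ F _ _ A B]) auto
    show "(LBINT u=v..\<infinity>. exp (Re s * u)) = 0 - exp (Re s * v) / Re s"
      by (rule interval_integral_FTC_nonneg(2)[OF _ F _ _ A B]) auto
  qed
  have AEeq: "AE u in lborel. indicator {v<..} u *\<^sub>R g u = (if v \<le> u then g u else 0)" for g :: "real \<Rightarrow> 'b::real_vector"
    using AE_lborel_singleton[of v] by eventually_elim (auto split: split_indicator)
  have e: "einterval (ereal v) \<infinity> = {v<..}" by (auto simp: einterval_def)
  have "integrable lborel (\<lambda>u. indicator {v<..} u *\<^sub>R exp (Re s * u))"
    using R(1) by (simp add: e set_integrable_def)
  then have I: "integrable lborel (\<lambda>u. indicator {v<..} u *\<^sub>R ?f u)"
    by (rule Bochner_Integration.integrable_bound) (auto split: split_indicator)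
  show 1: "integrable lborel (\<lambda>u. if v \<le> u then ?f u else 0)"
    using I by (rule integrable_cong_AE_imp) (auto intro: eventually_mono[OF AEeq])
  have "(CLBINT u=v..\<infinity>. ?f u) = 0 - ?F v"
  proof (rule interval_integral_FTC_integrable)
    show "set_integrable lborel (einterval v \<infinity>) ?f"
      using I by (simp add: e set_integrable_def)
    show "(?F has_vector_derivative ?f x) (at x)" for x
      using s0 by (auto intro!: derivative_eq_intros has_vector_derivative_real_field)
    have "((\<lambda>u. norm (?F u)) \<longlongrightarrow> 0 / norm s) at_top"
      unfolding norm_divide norm_exp_eq_Re using lim s0 by (intro tendsto_intros) auto
    then show "((?F \<circ> real_of_ereal) \<longlongrightarrow> 0) (at_left \<infinity>)"
      by (simp add: ereal_tendsto_simps tendsto_norm_zero_iff)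
    show "((?F \<circ> real_of_ereal) \<longlongrightarrow> ?F v) (at_right (ereal v))"
      using s0 by (auto simp: ereal_tendsto_simps intro!: tendsto_eq_intros)
  qed (auto intro!: continuous_intros)
  moreover have "(CLBINT u=v..\<infinity>. ?f u) = (CLBINT u. (if v \<le> u then ?f u else 0))"
    unfolding interval_lebesgue_integral_def set_lebesgue_integral_def
    by (simp add: e, rule integral_cong_AE) (auto intro: eventually_mono[OF AEeq])
  ultimately show "(CLBINT u. (if v \<le> u then ?f u else 0)) = - ?f v / s" by simp
  have "(LBINT u=v..\<infinity>. exp (Re s * u)) = (LBINT u. (if v \<le> u then exp (Re s * u) else 0))"
    unfolding interval_lebesgue_integral_def set_lebesgue_integral_def
    by (simp add: e, rule integral_cong_AE) (auto intro: eventually_mono[OF AEeq[of "\<lambda>u. exp (Re s * u)", simplified]])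
  then show "(LBINT u. norm (if v \<le> u then ?f u else 0)) = exp (Re s * v) / (- Re s)"
    unfolding R(2) by (simp add: if_distrib[of norm] cong: if_cong)
qed

text \<open>Fourier inversion applied to the function exp (c * u) * cdf D u, which is integrable because c < 0.\<close>

lemma mellin_inversion_cdf:
  assumes "real_distribution D" and nn: "AE v in D. v \<ge> 0" and c: "c < 0"
    and int: "integrable lborel (\<lambda>y. (CLINT v|D. exp (Complex c y * of_real v)) / (- Complex c y))"
  shows "complex_of_real (cdf D x) = 1 / (2 * pi) *
    (CLBINT y. (CLINT v|D. exp (Complex c y * of_real v)) / (- Complex c y) * exp (- Complex c y * of_real x))"
proof -
  interpret real_distribution D by fact
  interpret P: pair_sigma_finite D lborel ..
  define h where "h u = exp (c * u) * cdf D u" for u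
  \<comment> \<open>Integrating this kernel over v first gives exp (s u) times the distribution
    function; integrating over u first gives exp (s v) / (- s).\<close>
  let ?g = "\<lambda>s u v. if v \<le> u then exp (s * of_real u) else (0::complex)"
  have bound: "AE v in D. norm (exp (c * v)) \<le> 1"
    using nn by eventually_elim (use c in \<open>auto simp: mult_le_0_iff\<close>)
  have ie: "integrable D (\<lambda>v. exp (c * v))"
    by (rule integrable_const_bound[OF bound]) simp
  have joint: "integrable (D \<Otimes>\<^sub>M lborel) (\<lambda>(v, u). ?g s u v)" if s: "Re s = c" for s
  proof (rule P.Fubini_integrable)
    show "integrable D (\<lambda>v. LBINT u. norm (case (v, u) of (v, u) \<Rightarrow> ?g s u v))"
      using exp_half_line(3)[of s] ie s c by simp
    show "AE v in D. integrable lborel (\<lambda>u. case (v, u) of (v, u) \<Rightarrow> ?g s u v)"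
      using exp_half_line(1)[of s] s c by simp
  qed measurable
  have inner: "(CLINT v|D. ?g s u v) = exp (s * of_real u) * cdf D u" for s u
  proof -
    have "(CLINT v|D. ?g s u v) = (CLINT v|D. indicator {..u} v *\<^sub>R exp (s * of_real u))"
      by (intro Bochner_Integration.integral_cong) auto
    then show ?thesis by (simp add: cdf_def scaleR_conv_of_real)
  qed
  have swap: "(CLBINT u. exp (s * of_real u) * cdf D u) = (CLINT v|D. exp (s * of_real v)) / (- s)"
    and outer: "integrable lborel (\<lambda>u. exp (s * of_real u) * complex_of_real (cdf D u))" if s: "Re s = c" for s
  proof -
    have "(CLBINT u. (CLINT v|D. ?g s u v)) = (CLINT v|D. (CLBINT u. ?g s u v))"
      by (rule P.Fubini_integral[OF joint[OF s]])
    also have "\<dots> = (CLINT v|D. exp (s * of_real v) / (- s))"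
      using exp_half_line(2)[of s] s c by simp
    finally show "(CLBINT u. exp (s * of_real u) * cdf D u) = (CLINT v|D. exp (s * of_real v)) / (- s)"
      by (simp add: inner)
    show "integrable lborel (\<lambda>u. exp (s * of_real u) * complex_of_real (cdf D u))"
      using P.integrable_snd[OF joint[OF s]] by (simp add: inner)
  qed
  have hc: "complex_of_real (h u) = exp (of_real c * of_real u) * complex_of_real (cdf D u)" for u
    by (simp add: h_def exp_of_real flip: of_real_mult)
  have hi: "integrable lborel h"
    using outer[of "of_real c"] unfolding hc[symmetric] by (simp add: complex_of_real_integrable_eq)
  have h0: "h u \<ge> 0" for u by (simp add: h_def cdf_nonneg)
  have "complex_of_real (LBINT u. h u) = (CLINT v|D. exp (of_real c * of_real v)) / (- of_real c)"
    using swap[of "of_real c"] unfolding hc[symmetric] by simp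
  also have "\<dots> = complex_of_real (expectation (\<lambda>v. exp (c * v)) / (- c))"
    by (simp flip: of_real_mult add: exp_of_real)
  finally have "(LBINT u. h u) = expectation (\<lambda>v. exp (c * v)) / (- c)"
    using of_real_eq_iff by blast
  moreover have "expectation (\<lambda>v. exp (c * v)) > 0"
    by (rule expectation_greater[OF ie]) simp
  ultimately have pos: "(LBINT u. h u) > 0"
    using c by (simp add: divide_pos_neg)
  have H: "(CLBINT u. complex_of_real (h u) * iexp (y * u)) = (CLINT v|D. exp (Complex c y * of_real v)) / (- Complex c y)" for y
  proof -
    have "complex_of_real (h u) * iexp (y * u) = exp (Complex c y * of_real u) * cdf D u" for u
    proof -
      have "Complex c y * of_real u = of_real c * of_real u + \<i> * of_real (y * u)"
        by (simp add: complex_eq_iff)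
      then show ?thesis by (simp add: hc exp_add mult_ac)
    qed
    then show ?thesis using swap[of "Complex c y"] by simp
  qed
  have rc: "continuous (at_right x) h"
    unfolding h_def using cdf_is_right_cont[of x] by (intro continuous_intros)
  have "complex_of_real (h x) = 1 / (2 * pi) *
      (CLBINT y. (CLINT v|D. exp (Complex c y * of_real v)) / (- Complex c y) * iexp (- (y * x)))"
    using fourier_inversion[OF hi h0 pos _ rc] int unfolding H by simp
  \<comment> \<open>The damping factor exp (c x) is removed again and absorbed into the
    integrand.\<close>
  then have "exp (- (of_real c * of_real x)) * complex_of_real (h x) = exp (- (of_real c * of_real x)) * (1 / (2 * pi) *
      (CLBINT y. (CLINT v|D. exp (Complex c y * of_real v)) / (- Complex c y) * iexp (- (y * x))))"
    by (rule arg_cong)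
  also have "exp (- (of_real c * of_real x)) * complex_of_real (h x) = complex_of_real (cdf D x)"
    unfolding hc by (simp add: mult.assoc[symmetric] flip: exp_add)
  also have "exp (- (of_real c * of_real x)) * (1 / (2 * pi) *
      (CLBINT y. (CLINT v|D. exp (Complex c y * of_real v)) / (- Complex c y) * iexp (- (y * x))))
    = 1 / (2 * pi) * (CLBINT y. exp (- (of_real c * of_real x)) *
      ((CLINT v|D. exp (Complex c y * of_real v)) / (- Complex c y) * iexp (- (y * x))))"
    by (simp only: integral_mult_right_zero) (simp only: mult_ac)
  also have "(CLBINT y. exp (- (of_real c * of_real x)) *
      ((CLINT v|D. exp (Complex c y * of_real v)) / (- Complex c y) * iexp (- (y * x))))
    = (CLBINT y. (CLINT v|D. exp (Complex c y * of_real v)) / (- Complex c y) * exp (- Complex c y * of_real x))"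
  proof (intro Bochner_Integration.integral_cong refl)
    fix y
    have "- Complex c y * of_real x = - (of_real c * of_real x) + \<i> * of_real (- (y * x))"
      by (simp add: complex_eq_iff)
    then have "exp (- Complex c y * of_real x) = exp (- (of_real c * of_real x)) * iexp (- (y * x))"
      by (simp only: exp_add)
    then show "exp (- (of_real c * of_real x)) *
        ((CLINT v|D. exp (Complex c y * of_real v)) / (- Complex c y) * iexp (- (y * x)))
      = (CLINT v|D. exp (Complex c y * of_real v)) / (- Complex c y) * exp (- Complex c y * of_real x)"
      by (simp only: mult_ac)
  qed
  finally show ?thesis .
qed

section \<open>The generalized Fox function\<close>

text \<open>Up to a constant this is the Gamma density of shape j + 1 and scale b.\<close>

lemma integrable_power_exp:
  fixes b :: real
  assumes "b > 0"
  shows "set_integrable lborel {0<..} (\<lambda>t. t ^ j * exp (- t / b))"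
proof -
  interpret prob_space "gamma_measure (real j + 1) b"
    using assms by (intro prob_space_gamma_measure) auto
  have "(\<integral>\<^sup>+t. ennreal (gamma_density (real j + 1) b t) \<partial>lborel) = 1"
    using emeasure_space_1 by (simp add: gamma_measure_def emeasure_density)
  then have "integrable lborel (gamma_density (real j + 1) b)"
    using assms by (intro integrableI_nonneg) (auto simp: gamma_density_nonneg)
  then have "integrable lborel (\<lambda>t. Gamma (real j + 1) * b powr (real j + 1) * gamma_density (real j + 1) b t)"
    by (rule integrable_mult_right)
  moreover have G: "Gamma (real j + 1) > 0" by (intro Gamma_real_pos) auto
  have "Gamma (real j + 1) * b powr (real j + 1) * gamma_density (real j + 1) b t
      = indicator {0<..} t *\<^sub>R (t ^ j * exp (- t / b))" for t
    using assms less_imp_neq[OF G] by (auto simp: gamma_density_def powr_realpow split: split_indicator)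
  ultimately show ?thesis by (simp add: set_integrable_def)
qed

lemma tendsto_power_exp_at_top:
  fixes b :: real
  assumes "b > 0"
  shows "((\<lambda>t. t ^ j * exp (- t / b)) \<longlongrightarrow> 0) at_top"
proof -
  have "((\<lambda>t. (t / b) ^ j / exp (t / b)) \<longlongrightarrow> 0) at_top"
    using assms by (intro filterlim_compose[OF tendsto_power_div_exp_0])
      (auto simp: divide_inverse intro!: filterlim_tendsto_pos_mult_at_top[OF tendsto_const _ filterlim_ident] simp: mult.commute[of _ "inverse b"])
  then have "((\<lambda>t. b ^ j * ((t / b) ^ j / exp (t / b))) \<longlongrightarrow> b ^ j * 0) at_top"
    by (intro tendsto_intros)
  moreover have "b ^ j * ((t / b) ^ j / exp (t / b)) = t ^ j * exp (- t / b)" for t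
    using assms by (simp add: power_divide exp_minus field_simps)
  ultimately show ?thesis by simp
qed

text \<open>One integration by parts gives decay of order 1 / y. The boundary term at 0 does not vanish
  when n = 0, so this rate is the best possible for the exponential distribution.\<close>

lemma gamma_mellin_integral_parts:
  fixes n :: nat and b c :: real
  assumes b: "b > 0" and c: "c < 0"
  shows "\<exists>B. \<forall>y. \<bar>y\<bar> * norm (CLBINT t:{0<..}. complex_of_real (t ^ n * exp (- t / b)) * exp (Complex c y * of_real (ln (1 + t)))) \<le> B"
proof -
  define u where "u t = t ^ n * exp (- t / b)" for t :: real
  \<comment> \<open>For n = 0 the truncated exponent \<open>n - 1\<close> does no harm, as its
    coefficient is 0.\<close>
  define u' where "u' t = (real n * t ^ (n - 1) - t ^ n / b) * exp (- t / b)" for t :: real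
  have du: "(u has_real_derivative u' t) (at t)" for t
    unfolding u_def u'_def using b by (auto intro!: derivative_eq_intros simp: algebra_simps)
  have uc: "isCont u t" "isCont u' t" for t
    unfolding u_def u'_def using b by (auto intro!: continuous_intros)
  have um [measurable]: "u \<in> borel_measurable borel" "u' \<in> borel_measurable borel"
    using uc by (auto intro!: borel_measurable_continuous_onI continuous_at_imp_continuous_on)
  have ui: "set_integrable lborel {0<..} u"
    unfolding u_def by (rule integrable_power_exp[OF b])
  have wi: "set_integrable lborel {0<..} (\<lambda>t. norm (u' t) * (1 + t))"
  proof -
    have "set_integrable lborel {0<..} (\<lambda>t. real n * (t ^ (n - 1) * exp (- t / b)) + 1 / b * (t ^ n * exp (- t / b))
       + real n * (t ^ (Suc (n - 1)) * exp (- t / b)) + 1 / b * (t ^ (Suc n) * exp (- t / b)))"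
      by (intro set_integral_add set_integrable_mult_right integrable_power_exp b)
    then show ?thesis
    proof (rule set_integrable_bound)
      show "AE t in lborel. t \<in> {0<..} \<longrightarrow> norm (norm (u' t) * (1 + t)) \<le> norm (real n * (t ^ (n - 1) * exp (- t / b)) + 1 / b * (t ^ n * exp (- t / b))
       + real n * (t ^ (Suc (n - 1)) * exp (- t / b)) + 1 / b * (t ^ (Suc n) * exp (- t / b)))"
      proof (intro AE_I2 impI)
        fix t :: real assume t: "t \<in> {0<..}"
        have "norm (u' t) = \<bar>real n * t ^ (n - 1) - t ^ n / b\<bar> * exp (- t / b)"
          by (simp add: u'_def abs_mult)
        also have "\<dots> \<le> (real n * t ^ (n - 1) + t ^ n / b) * exp (- t / b)"
        proof (rule mult_right_mono)
          have "real n * t ^ (n - 1) \<ge> 0" "t ^ n / b \<ge> 0" using t b by auto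
          then show "\<bar>real n * t ^ (n - 1) - t ^ n / b\<bar> \<le> real n * t ^ (n - 1) + t ^ n / b" by linarith
        qed simp
        finally have "norm (norm (u' t) * (1 + t)) \<le> (real n * t ^ (n - 1) + t ^ n / b) * exp (- t / b) * (1 + t)"
          using t by (auto intro!: mult_right_mono)
        also have "\<dots> = real n * (t ^ (n - 1) * exp (- t / b)) + 1 / b * (t ^ n * exp (- t / b))
            + real n * (t ^ (Suc (n - 1)) * exp (- t / b)) + 1 / b * (t ^ (Suc n) * exp (- t / b))"
          by (simp add: algebra_simps add_divide_distrib)
        finally show "norm (norm (u' t) * (1 + t)) \<le> norm (real n * (t ^ (n - 1) * exp (- t / b)) + 1 / b * (t ^ n * exp (- t / b))
            + real n * (t ^ (Suc (n - 1)) * exp (- t / b)) + 1 / b * (t ^ (Suc n) * exp (- t / b)))"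
          by simp
      qed
    qed (simp add: set_borel_measurable_def)
  qed
  \<comment> \<open>The summand 1 covers the boundary term \<open>0 ^ n\<close> at t = 0. The factor
    1 + t bounds |(1 + t)^(s+1)|, since c + 1 < 1.\<close>
  define Bd where "Bd = 1 + (LBINT t:{0<..}. norm (u' t) * (1 + t))"
  have main: "\<bar>y\<bar> * norm (CLBINT t:{0<..}. of_real (u t) * exp (Complex c y * of_real (ln (1 + t)))) \<le> Bd" for y
  proof (cases "y = 0")
    case True
    have "0 \<le> (LBINT t:{0<..}. norm (u' t) * (1 + t))"
      unfolding set_lebesgue_integral_def by (intro integral_nonneg_AE AE_I2) (auto split: split_indicator)
    then show ?thesis using True by (simp add: Bd_def)
  next
    case False
    define s where "s = Complex c y"
    \<comment> \<open>This is (1 + t)^z. The antiderivative used is u(t) (1 + t)^(s+1), whose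
      derivative contains (s + 1) times the wanted integrand; |y| <= |s + 1| then gives the
      decay.\<close>
    define e where "e z t = exp (z * complex_of_real (ln (1 + t)))" for z t
    have en: "norm (e z t) = (1 + t) powr Re z" if "t > 0" for z t
      using that by (simp add: e_def powr_def mult.commute)
    have e1: "norm (e (s + 1) t) \<le> 1 + t" if "t > 0" for t
      using that c powr_mono[of "c + 1" 1 "1 + t"] en[of t "s + 1"] by (simp add: s_def)
    have em [measurable]: "e z \<in> borel_measurable borel" for z
      unfolding e_def by measurable
    have s1: "\<bar>y\<bar> \<le> norm (s + 1)"
      using abs_Im_le_cmod[of "s + 1"] by (simp add: s_def)
    have A: "set_integrable lborel {0<..} (\<lambda>t. of_real (u' t) * e (s + 1) t)"
    proof (rule set_integrable_bound[OF wi])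
      show "AE t in lborel. t \<in> {0<..} \<longrightarrow> norm (of_real (u' t) * e (s + 1) t) \<le> norm (norm (u' t) * (1 + t))"
      proof (intro AE_I2 impI)
        fix t :: real assume t: "t \<in> {0<..}"
        have "norm (e (s + 1) t) \<le> 1 + t"
          using t by (intro e1) simp
        then show "norm (of_real (u' t) * e (s + 1) t) \<le> norm (norm (u' t) * (1 + t))"
          using t by (auto simp: norm_mult intro!: mult_left_mono)
      qed
    qed (simp add: set_borel_measurable_def)
    have Bi: "set_integrable lborel {0<..} (\<lambda>t. of_real (u t) * e s t)"
    proof (rule set_integrable_bound[OF ui])
      show "AE t in lborel. t \<in> {0<..} \<longrightarrow> norm (of_real (u t) * e s t) \<le> norm (u t)"
      proof (intro AE_I2 impI)
        fix t :: real assume t: "t \<in> {0<..}"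
        have "norm (e s t) \<le> 1"
          using t c powr_mono[of c 0 "1 + t"] en[of t s] by (simp add: s_def)
        then show "norm (of_real (u t) * e s t) \<le> norm (u t)"
          using t by (auto simp: norm_mult intro!: mult_left_le)
      qed
    qed (simp add: set_borel_measurable_def)
    let ?F = "\<lambda>t. of_real (u t) * e (s + 1) t"
    let ?f = "\<lambda>t. of_real (u' t) * e (s + 1) t + (s + 1) * (of_real (u t) * e s t)"
    have ei: "einterval 0 \<infinity> = {0::real<..}" by (auto simp: einterval_def zero_ereal_def)
    have fi: "set_integrable lborel {0<..} ?f"
      by (intro set_integral_add A set_integrable_mult_right Bi)
    have "(CLBINT t=0..\<infinity>. ?f t) = 0 - of_real (0 ^ n)"
    proof (rule interval_integral_FTC_integrable)
      show "set_integrable lborel (einterval 0 \<infinity>) ?f" unfolding ei by (rule fi)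
      fix t assume "0 < ereal t"
      then have t: "t > 0" by (simp add: zero_ereal_def)
      have de: "(e z has_vector_derivative z * e (z - 1) t) (at t)" for z
      proof -
        have "e (z - 1) t = e z t * of_real (inverse (1 + t))"
          using t by (simp add: e_def left_diff_distrib exp_diff exp_of_real divide_inverse)
        moreover have "((\<lambda>t. complex_of_real (ln (1 + t))) has_vector_derivative of_real (inverse (1 + t))) (at t)"
          using t by (intro has_vector_derivative_of_real) (auto intro!: derivative_eq_intros simp: has_real_derivative_iff_has_vector_derivative[symmetric] divide_inverse)
        then have "(e z has_vector_derivative (of_real (inverse (1 + t)) * (z * exp (z * of_real (ln (1 + t)))))) (at t)"
          unfolding e_def
          by (intro field_vector_diff_chain_at[where g = "\<lambda>w. exp (z * w)", unfolded o_def])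
             (auto intro!: derivative_eq_intros)
        ultimately show ?thesis by (simp add: e_def mult_ac)
      qed
      have "((\<lambda>t. complex_of_real (u t)) has_vector_derivative of_real (u' t)) (at t)"
        using du[of t] by (intro has_vector_derivative_of_real) (simp add: has_real_derivative_iff_has_vector_derivative)
      from has_vector_derivative_mult[OF this de[of "s + 1"]]
      show "(?F has_vector_derivative ?f t) (at t)" by (simp add: algebra_simps)
      have "isCont (e z) t" for z using de[of z] by (rule has_vector_derivative_continuous)
      then show "isCont ?f t" using uc[of t] by (intro continuous_intros)
    next
      have e0: "((\<lambda>t. e (s + 1) t) \<longlongrightarrow> 1) (at_right 0)"
        unfolding e_def by (auto intro!: tendsto_eq_intros)
      have "(u \<longlongrightarrow> u 0) (at_right 0)"
        using uc(1)[of 0] by (simp add: isCont_def filterlim_at_split)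
      then have "((\<lambda>t. of_real (u t) * e (s + 1) t) \<longlongrightarrow> of_real (u 0) * 1) (at_right 0)"
        using e0 by (intro tendsto_intros)
      then show "((?F \<circ> real_of_ereal) \<longlongrightarrow> of_real (0 ^ n)) (at_right 0)"
        by (simp add: zero_ereal_def ereal_tendsto_simps u_def)
      have lim: "((\<lambda>t. t ^ n * exp (- t / b) + t ^ Suc n * exp (- t / b)) \<longlongrightarrow> 0) at_top"
        by (intro tendsto_add_zero tendsto_power_exp_at_top b)
      have "((\<lambda>t. of_real (u t) * e (s + 1) t) \<longlongrightarrow> 0) at_top"
      proof (rule Lim_null_comparison[OF _ lim])
        show "\<forall>\<^sub>F t in at_top. norm (of_real (u t) * e (s + 1) t) \<le> t ^ n * exp (- t / b) + t ^ Suc n * exp (- t / b)"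
          using eventually_gt_at_top[of 0]
        proof eventually_elim
          case (elim t)
          have "norm (e (s + 1) t) \<le> 1 + t"
            using elim by (intro e1) simp
          then have "u t * norm (e (s + 1) t) \<le> u t * (1 + t)"
            using elim by (intro mult_left_mono) (auto simp: u_def)
          then show ?case using elim by (simp add: norm_mult norm_power u_def abs_mult algebra_simps)
        qed
      qed
      then show "((?F \<circ> real_of_ereal) \<longlongrightarrow> 0) (at_left \<infinity>)"
        by (simp add: ereal_tendsto_simps)
    qed simp
    moreover have "(CLBINT t=0..\<infinity>. ?f t) = (CLBINT t:{0<..}. of_real (u' t) * e (s + 1) t)
        + (s + 1) * (CLBINT t:{0<..}. of_real (u t) * e s t)"
      using set_integral_add(2)[OF A set_integrable_mult_right[OF Bi]]
      by (simp add: interval_lebesgue_integral_def ei)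
    ultimately have "(s + 1) * (CLBINT t:{0<..}. of_real (u t) * e s t)
        = - of_real (0 ^ n) - (CLBINT t:{0<..}. of_real (u' t) * e (s + 1) t)"
      by (simp add: eq_diff_eq add.commute)
    then have "norm (s + 1) * norm (CLBINT t:{0<..}. of_real (u t) * e s t)
        = norm (- of_real (0 ^ n) - (CLBINT t:{0<..}. of_real (u' t) * e (s + 1) t))"
      by (metis norm_mult)
    also have "\<dots> \<le> norm (- of_real (0 ^ n) :: complex) + norm (CLBINT t:{0<..}. of_real (u' t) * e (s + 1) t)"
      by (rule norm_triangle_ineq4)
    also have "\<dots> \<le> 1 + (LBINT t:{0<..}. norm (u' t) * (1 + t))"
    proof (rule add_mono)
      show "norm (- of_real (0 ^ n) :: complex) \<le> 1" by (cases n) auto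
      have "norm (CLBINT t:{0<..}. of_real (u' t) * e (s + 1) t) \<le> (LBINT t:{0<..}. norm (of_real (u' t) * e (s + 1) t))"
        by (rule set_integral_norm_bound[OF A])
      also have "\<dots> \<le> (LBINT t:{0<..}. norm (u' t) * (1 + t))"
      proof (rule set_integral_mono[OF set_integrable_norm[OF A] wi])
        fix t :: real assume t: "t \<in> {0<..}"
        have "norm (e (s + 1) t) \<le> 1 + t"
          using t by (intro e1) simp
        then show "norm (of_real (u' t) * e (s + 1) t) \<le> norm (u' t) * (1 + t)"
          using t by (auto simp: norm_mult intro!: mult_left_mono)
      qed
      finally show "norm (CLBINT t:{0<..}. of_real (u' t) * e (s + 1) t) \<le> (LBINT t:{0<..}. norm (u' t) * (1 + t))" .
    qed
    finally have "norm (s + 1) * norm (CLBINT t:{0<..}. of_real (u t) * e s t) \<le> Bd"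
      by (simp add: Bd_def)
    moreover have "\<bar>y\<bar> * norm (CLBINT t:{0<..}. of_real (u t) * e s t) \<le> norm (s + 1) * norm (CLBINT t:{0<..}. of_real (u t) * e s t)"
      using s1 by (rule mult_right_mono) simp
    ultimately show ?thesis by (simp add: e_def s_def)
  qed
  then show ?thesis unfolding u_def by blast
qed

text \<open>This is the expectation of (1 + R) powr s; the maximum only keeps the logarithm bounded below on the
  null set of negative r.\<close>

definition gamma_mellin :: "real \<Rightarrow> real \<Rightarrow> complex \<Rightarrow> complex" where
  "gamma_mellin a b s = (CLINT r|gamma_measure a b. exp (s * of_real (ln (1 + max 0 r))))"

lemma AE_gamma_measure_pos: "AE r in gamma_measure a b. r > 0"
  unfolding gamma_measure_def
  by (subst AE_density) (auto simp: gamma_density_def split: if_splits)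

lemma gamma_mellin_altdef:
  assumes "a > 0" "b > 0"
  shows "gamma_mellin a b s = of_real (1 / (Gamma a * b powr a)) *
    (CLBINT t:{0<..}. of_real (t powr (a - 1) * exp (- t / b)) * exp (s * of_real (ln (1 + t))))"
proof -
  have "gamma_mellin a b s = (CLBINT t. gamma_density a b t *\<^sub>R exp (s * of_real (ln (1 + max 0 t))))"
    unfolding gamma_mellin_def gamma_measure_def
    using assms by (subst integral_density) (auto simp: gamma_density_nonneg)
  also have "\<dots> = (CLBINT t. of_real (1 / (Gamma a * b powr a)) *
      (indicator {0<..} t *\<^sub>R (of_real (t powr (a - 1) * exp (- t / b)) * exp (s * of_real (ln (1 + t))))))"
    by (intro Bochner_Integration.integral_cong)
       (auto simp: gamma_density_def scaleR_conv_of_real split: split_indicator)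
  finally show ?thesis by (simp only: set_lebesgue_integral_def integral_mult_right_zero)
qed

lemma norm_gamma_mellin_le_1:
  assumes "a > 0" "b > 0" "Re s \<le> 0"
  shows "norm (gamma_mellin a b s) \<le> 1"
proof -
  interpret prob_space "gamma_measure a b" using assms by (intro prob_space_gamma_measure)
  have le: "norm (exp (s * of_real (ln (1 + max 0 r)))) \<le> 1" for r :: real
    using assms by (simp add: mult_nonpos_nonneg)
  have "norm (gamma_mellin a b s) \<le> (LINT r|gamma_measure a b. norm (exp (s * of_real (ln (1 + max 0 r)))))"
    unfolding gamma_mellin_def by (rule integral_norm_bound)
  also have "\<dots> \<le> 1"
    using le by (intro integral_le_const integrable_const_bound[where B = 1]) auto
  finally show ?thesis .
qed

text \<open>An integer shape n makes the density a natural power times an exponential, the form to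
  which the integration by parts applies.\<close>

lemma gamma_mellin_decay:
  assumes "b > 0" "c < 0" "n \<ge> 1"
  shows "\<exists>B. \<forall>y. \<bar>y\<bar> * norm (gamma_mellin (real n) b (Complex c y)) \<le> B"
proof -
  obtain B where B: "\<And>y. \<bar>y\<bar> * norm (CLBINT t:{0<..}. complex_of_real (t ^ (n - 1) * exp (- t / b)) * exp (Complex c y * of_real (ln (1 + t)))) \<le> B"
    using gamma_mellin_integral_parts[OF assms(1,2), of "n - 1"] by blast
  define C where "C = 1 / (Gamma (real n) * b powr real n)"
  have C: "C \<ge> 0" using assms Gamma_real_pos[of "real n"] by (simp add: C_def)
  have "\<bar>y\<bar> * norm (gamma_mellin (real n) b (Complex c y)) \<le> C * B" for y
  proof -
    have "(CLBINT t:{0<..}. complex_of_real (t powr (real n - 1) * exp (- t / b)) * exp (Complex c y * of_real (ln (1 + t))))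
        = (CLBINT t:{0<..}. complex_of_real (t ^ (n - 1) * exp (- t / b)) * exp (Complex c y * of_real (ln (1 + t))))"
      using assms(3) by (intro set_lebesgue_integral_cong) (auto simp: powr_realpow[symmetric] of_nat_diff)
    then have "gamma_mellin (real n) b (Complex c y) = of_real C *
       (CLBINT t:{0<..}. complex_of_real (t ^ (n - 1) * exp (- t / b)) * exp (Complex c y * of_real (ln (1 + t))))"
      using assms by (subst gamma_mellin_altdef) (auto simp: C_def)
    then show ?thesis
      using mult_left_mono[OF B[of y] C] C by (simp add: norm_mult mult_ac)
  qed
  then show ?thesis by blast
qed

lemma measurable_gamma_mellin [measurable]:
  assumes "a > 0" "b > 0"
  shows "(\<lambda>y. gamma_mellin a b (Complex c y)) \<in> borel_measurable borel"
proof -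
  interpret prob_space "gamma_measure a b" using assms by (intro prob_space_gamma_measure)
  have [measurable]: "(\<lambda>y. Complex c y) \<in> borel_measurable borel"
    unfolding borel_measurable_complex_iff by simp
  show ?thesis unfolding gamma_mellin_def by measurable
qed

section \<open>The kernel in closed form and the Mellin--Barnes integral\<close>

text \<open>The second argument \<phi> + 1 + s of Psi leaves exactly the exponent s on 1 + t, so
  Tricomi's integral is an unnormalised Gamma expectation. The prefactor (1 / \<Omega>)^(\<phi> + s)
  supplies the missing normalisation and the scale \<Omega>^(-s).\<close>

lemma Yfac_plus_gamma:
  assumes "\<Omega> > 0" "\<phi> > 0"
  shows "Yfac_plus (1, 1, 1 / \<Omega>, \<phi>) s = exp (- s * of_real (ln \<Omega>)) * gamma_mellin \<phi> \<Omega> s"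
proof -
  have "tricomi_Psi \<phi> (of_real \<phi> + 1 + s) (1 / \<Omega>) = of_real (1 / Gamma \<phi>) *
      (CLBINT t:{0<..}. of_real (t powr (\<phi> - 1) * exp (- t / \<Omega>)) * exp (s * of_real (ln (1 + t))))"
    unfolding tricomi_Psi_def
  proof (intro arg_cong2[where f = "(*)"] refl set_lebesgue_integral_cong)
    show "\<forall>t. t \<in> {0<..} \<longrightarrow> complex_of_real (exp (- (1 / \<Omega>) * t) * t powr (\<phi> - 1)) *
        complex_of_real (1 + t) powr (complex_of_real \<phi> + 1 + s - complex_of_real \<phi> - 1)
      = of_real (t powr (\<phi> - 1) * exp (- t / \<Omega>)) * exp (s * of_real (ln (1 + t)))"
    proof (intro allI impI)
      fix t :: real assume t: "t \<in> {0<..}"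
      have "complex_of_real (1 + t) powr s = exp (s * of_real (ln (1 + t)))"
        using t by (subst powr_def) (auto simp: Ln_of_real simp del: of_real_add)
      moreover have "complex_of_real \<phi> + 1 + s - complex_of_real \<phi> - 1 = s" by simp
      ultimately show "complex_of_real (exp (- (1 / \<Omega>) * t) * t powr (\<phi> - 1)) *
          complex_of_real (1 + t) powr (complex_of_real \<phi> + 1 + s - complex_of_real \<phi> - 1)
        = of_real (t powr (\<phi> - 1) * exp (- t / \<Omega>)) * exp (s * of_real (ln (1 + t)))"
        by (simp only:) (simp add: mult_ac)
    qed
  qed simp
  moreover have "complex_of_real (1 / \<Omega>) powr (of_real \<phi> + 1 + s - 1) = of_real (1 / \<Omega> powr \<phi>) * exp (- s * of_real (ln \<Omega>))"
  proof -
    have "of_real \<phi> + 1 + s - 1 = of_real \<phi> + s" by simp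
    moreover have "complex_of_real (1 / \<Omega>) powr (of_real \<phi> + s) = exp ((of_real \<phi> + s) * of_real (ln (1 / \<Omega>)))"
      using assms by (subst powr_def) (auto simp: Ln_of_real simp del: of_real_divide)
    moreover have "\<dots> = exp (of_real (- (\<phi> * ln \<Omega>))) * exp (- s * of_real (ln \<Omega>))"
      using assms by (simp add: ln_div algebra_simps flip: exp_add)
    moreover have "exp (complex_of_real (- (\<phi> * ln \<Omega>))) = of_real (1 / \<Omega> powr \<phi>)"
      using assms unfolding exp_of_real by (simp add: powr_def exp_minus divide_inverse)
    ultimately show ?thesis by (simp only:)
  qed
  moreover have "Yfac_plus (1, 1, 1 / \<Omega>, \<phi>) s
      = complex_of_real (1 / \<Omega>) powr (of_real \<phi> + 1 + s - 1) * tricomi_Psi \<phi> (of_real \<phi> + 1 + s) (1 / \<Omega>)"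
    using assms by (simp add: Yfac_plus_def yfac_def)
  ultimately show ?thesis
    using gamma_mellin_altdef[OF assms(2,1), of s] by simp
qed

text \<open>The two rows with A = 0 contribute Gamma (- s) / Gamma (1 - s) = 1 / (- s). The
  condition Re s < 0 avoids the poles and puts the arguments 1 - s and 2 - s in the range Re > 1,
  where the convention of \<open>yfac\<close> is a genuine limit.\<close>

lemma Y_kernel_gamma:
  assumes "\<And>k. k \<in> {1..K} \<Longrightarrow> \<Omega> k > 0" "\<And>k. k \<in> {1..K} \<Longrightarrow> \<phi> k > 0" and s: "Re s < 0"
  shows "Y_kernel K 1 1 (K + 1) (\<lambda>_. (1, 1, 0, 1))
      (\<lambda>j. if j = K + 1 then (0, 1, 0, 1) else (1, 1, 1 / \<Omega> j, \<phi> j)) s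
    = exp (- s * of_real (ln (\<Prod>k\<in>{1..K}. \<Omega> k))) * (\<Prod>k\<in>{1..K}. gamma_mellin (\<phi> k) (\<Omega> k) s) / (- s)"
proof -
  have "(\<Prod>j\<in>{1..K}. Yfac_plus (if j = K + 1 then (0, 1, 0, 1) else (1, 1, 1 / \<Omega> j, \<phi> j)) s)
      = (\<Prod>k\<in>{1..K}. exp (- s * of_real (ln (\<Omega> k))) * gamma_mellin (\<phi> k) (\<Omega> k) s)"
    using assms by (intro prod.cong) (auto simp: Yfac_plus_gamma)
  also have "\<dots> = exp (\<Sum>k\<in>{1..K}. - s * of_real (ln (\<Omega> k))) * (\<Prod>k\<in>{1..K}. gamma_mellin (\<phi> k) (\<Omega> k) s)"
    by (simp add: prod.distrib exp_sum)
  also have "(\<Sum>k\<in>{1..K}. - s * of_real (ln (\<Omega> k))) = - s * of_real (ln (\<Prod>k\<in>{1..K}. \<Omega> k))"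
  proof -
    have "\<Omega> k \<noteq> 0" if "k \<in> {1..K}" for k using assms(1)[OF that] by simp
    then show ?thesis using assms(1) by (subst ln_prod) (simp_all only: sum_distrib_left of_real_sum, auto)
  qed
  finally have 1: "(\<Prod>j\<in>{1..K}. Yfac_plus (if j = K + 1 then (0, 1, 0, 1) else (1, 1, 1 / \<Omega> j, \<phi> j)) s)
      = exp (- s * of_real (ln (\<Prod>k\<in>{1..K}. \<Omega> k))) * (\<Prod>k\<in>{1..K}. gamma_mellin (\<phi> k) (\<Omega> k) s)" .
  have np: "- s \<notin> \<int>\<^sub>\<le>\<^sub>0"
  proof
    assume "- s \<in> \<int>\<^sub>\<le>\<^sub>0"
    then obtain i where "- s = of_int i" "i \<le> 0" by (elim nonpos_Ints_cases)
    from arg_cong[OF this(1), of Re] this(2) s show False by simp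
  qed
  have "Gamma (1 - s) = - s * Gamma (- s)"
    using Gamma_plus1[OF np] by (simp add: add.commute)
  moreover have "Gamma (- s) \<noteq> 0" using np by (simp add: Gamma_eq_zero_iff)
  ultimately have "Gamma (- s) / Gamma (1 - s) = 1 / (- s)" by (simp add: field_simps)
  then have 2: "(\<Prod>i\<in>{1..1::nat}. Yfac_minus (1, 1, 0, 1) s) / (\<Prod>j\<in>{K+1..K+1}. Yfac_minus (if j = K + 1 then (0, 1, 0, 1) else (1, 1, 1 / \<Omega> j, \<phi> j)) s)
      = 1 / (- s)"
    by (simp add: Yfac_minus_def yfac_def)
  show ?thesis
    unfolding Y_kernel_def 1 2 by simp
qed

text \<open>Adding the two bounds gives the majorant (p + B) / (1 + y^2), a multiple of the
  derivative of arctan.\<close>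

lemma integrable_inverse_square_decay:
  fixes f :: "real \<Rightarrow> complex"
  assumes [measurable]: "f \<in> borel_measurable borel"
    and p: "\<And>y. norm (f y) \<le> p" and B: "\<And>y. y\<^sup>2 * norm (f y) \<le> B"
  shows "integrable lborel f"
proof -
  have "set_integrable lborel (einterval (-\<infinity>) \<infinity>) (\<lambda>y. 1 / (1 + y\<^sup>2))"
  proof (rule interval_integral_FTC_nonneg)
    show "DERIV arctan y :> 1 / (1 + y\<^sup>2)" for y
      by (auto intro!: derivative_eq_intros simp: inverse_eq_divide)
    show "isCont (\<lambda>y. 1 / (1 + y\<^sup>2)) y" for y :: real
      by (auto intro!: continuous_intros simp: add_nonneg_eq_0_iff)
    show "((arctan \<circ> real_of_ereal) \<longlongrightarrow> - (pi / 2)) (at_right (-\<infinity>))"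
      using tendsto_arctan_at_bot by (simp add: ereal_tendsto_simps)
    show "((arctan \<circ> real_of_ereal) \<longlongrightarrow> pi / 2) (at_left \<infinity>)"
      using tendsto_arctan_at_top by (simp add: ereal_tendsto_simps)
  qed auto
  then have "integrable lborel (\<lambda>y::real. (p + B) * (1 / (1 + y\<^sup>2)))"
    by (intro integrable_mult_right) (simp add: set_integrable_def)
  then show ?thesis
  proof (rule Bochner_Integration.integrable_bound, simp, intro AE_I2)
    fix y
    have "norm (f y) * (1 + y\<^sup>2) \<le> p + B"
      using p[of y] B[of y] by (simp add: algebra_simps)
    then have "norm (f y) \<le> (p + B) / (1 + y\<^sup>2)"
      by (simp add: pos_le_divide_eq add_pos_nonneg)
    moreover have "p \<ge> 0" using p[of 0] norm_ge_zero[of "f 0"] by linarith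
    moreover have "B \<ge> 0" using B[of 0] by simp
    ultimately show "norm (f y) \<le> norm ((p + B) * (1 / (1 + y\<^sup>2)))" by simp
  qed
qed

text \<open>The Gamma factors of the kernel contribute - 1 / s and one Mellin transform decays like 1 / y,
  so the Mellin--Barnes integral converges absolutely already for K = 1.\<close>

lemma prod_gamma_cdf_eq_foxY:
  fixes n :: "nat \<Rightarrow> nat"
  assumes K: "K \<ge> 1" and \<Omega>: "\<And>k. k \<in> {1..K} \<Longrightarrow> \<Omega> k > 0" and n: "\<And>k. k \<in> {1..K} \<Longrightarrow> n k \<ge> 1"
    and x: "x > 0" and c: "c < 0"
  shows "complex_of_real (prod_gamma_cdf K (\<lambda>k. real (n k)) \<Omega> x) =
    foxY K 1 1 (K + 1) (\<lambda>_. (1, 1, 0, 1))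
      (\<lambda>j. if j = K + 1 then (0, 1, 0, 1) else (1, 1, 1 / \<Omega> j, real (n j)))
      c (x / (\<Prod>k\<in>{1..K}. \<Omega> k))"
proof -
  define E where "E k s = gamma_mellin (real (n k)) (\<Omega> k) s" for k s
  define Q where "Q k = (if k \<in> {1..K} then gamma_measure (real (n k)) (\<Omega> k) else return borel 0)" for k
  \<comment> \<open>Almost surely V = ln A. Being a sum, it makes the transform factor over
    k.\<close>
  define V where "V r = (\<Sum>k\<in>{1..K}. ln (1 + max 0 (r k)))" for r :: "nat \<Rightarrow> real"
  have prQ: "prob_space (Q k)" for k
    unfolding Q_def using \<Omega> n by (auto intro!: prob_space_gamma_measure prob_space_return simp: Suc_le_eq)
  interpret Q: prob_space "Q k" for k by (rule prQ)
  interpret PQ: product_sigma_finite Q ..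
  interpret N: prob_space "PiM {1..K} Q" by (rule prob_space_PiM) (rule prQ)
  have sQ [measurable_cong]: "sets (Q k) = sets borel" for k by (simp add: Q_def)
  have cm: "(\<lambda>r. r k) \<in> borel_measurable (PiM {1..K} Q)" if "k \<in> {1..K}" for k
    using measurable_component_singleton[OF that, of Q] measurable_cong_sets[OF refl sQ] by blast
  have Vm [measurable]: "V \<in> borel_measurable (PiM {1..K} Q)"
    unfolding V_def[abs_def]
    by (intro borel_measurable_sum borel_measurable_ln borel_measurable_add borel_measurable_max borel_measurable_const cm)
  define D where "D = distr (PiM {1..K} Q) borel V"
  have pD: "prob_space D" unfolding D_def by (rule N.prob_space_distr[OF Vm])
  have rD: "real_distribution D"
    by (intro real_distribution.intro real_distribution_axioms.intro pD) (simp_all add: D_def)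
  have nnD: "AE v in D. v \<ge> 0"
    unfolding D_def by (subst AE_distr_iff[OF Vm]) (auto simp: V_def intro!: sum_nonneg AE_I2)
  have cdf: "cdf D (ln x) = prod_gamma_cdf K (\<lambda>k. real (n k)) \<Omega> x"
  proof -
    have Neq: "PiM {1..K} (\<lambda>k. density lborel (\<lambda>r. ennreal (gamma_density (real (n k)) (\<Omega> k) r))) = PiM {1..K} Q"
      by (intro PiM_cong) (auto simp: Q_def gamma_measure_def)
    have "AE r in PiM {1..K} Q. r k > 0" if k: "k \<in> {1..K}" for k
    proof (rule AE_PiM_component[OF prQ])
      show "AE r in Q k. r > 0"
      proof -
        have "Q k = gamma_measure (real (n k)) (\<Omega> k)" using k by (simp add: Q_def)
        then show ?thesis using AE_gamma_measure_pos by (simp only:)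
      qed
    qed fact
    then have "AE r in PiM {1..K} Q. \<forall>k\<in>{1..K}. r k > 0"
      by (intro AE_finite_allI) auto
    then have ae: "AE r in PiM {1..K} Q. (V r \<le> ln x) \<longleftrightarrow> (\<Prod>k\<in>{1..K}. 1 + r k) \<le> x"
    proof eventually_elim
      case (elim r)
      have "V r = (\<Sum>k\<in>{1..K}. ln (1 + r k))"
        unfolding V_def using elim by (intro sum.cong) (auto simp: max_def dest!: bspec)
      also have "\<dots> = ln (\<Prod>k\<in>{1..K}. 1 + r k)"
        using elim by (intro ln_prod[symmetric]) (force dest: bspec)+
      finally have "V r = ln (\<Prod>k\<in>{1..K}. 1 + r k)" .
      moreover have "(\<Prod>k\<in>{1..K}. 1 + r k) > 0"
        using elim by (intro prod_pos) (auto intro: add_pos_pos)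
      ultimately show ?case using x by simp
    qed
    have "cdf D (ln x) = measure (PiM {1..K} Q) {r \<in> space (PiM {1..K} Q). V r \<le> ln x}"
      unfolding cdf_def D_def by (subst measure_distr[OF Vm]) (auto intro!: arg_cong[where f = "measure _"])
    also have "\<dots> = measure (PiM {1..K} Q) {r \<in> space (PiM {1..K} Q). (\<Prod>k\<in>{1..K}. 1 + r k) \<le> x}"
    proof (rule N.finite_measure_eq_AE)
      show "AE r in PiM {1..K} Q. r \<in> {r \<in> space (PiM {1..K} Q). V r \<le> ln x} \<longleftrightarrow>
          r \<in> {r \<in> space (PiM {1..K} Q). (\<Prod>k\<in>{1..K}. 1 + r k) \<le> x}"
        using ae by (rule eventually_mono) blast
      have "(\<lambda>r. \<Prod>k\<in>{1..K}. 1 + r k) \<in> borel_measurable (PiM {1..K} Q)"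
        by (intro borel_measurable_prod borel_measurable_add borel_measurable_const cm)
      then show "{r \<in> space (PiM {1..K} Q). (\<Prod>k\<in>{1..K}. 1 + r k) \<le> x} \<in> N.events"
        by (rule borel_measurable_le[OF _ borel_measurable_const])
      show "{r \<in> space (PiM {1..K} Q). V r \<le> ln x} \<in> N.events"
        by (rule borel_measurable_le[OF Vm borel_measurable_const])
    qed
    finally show ?thesis unfolding prod_gamma_cdf_def Let_def Neq .
  qed
  have char: "(CLINT v|D. exp (s * of_real v)) = (\<Prod>k\<in>{1..K}. E k s)" if s: "Re s < 0" for s
  proof -
    have "(CLINT v|D. exp (s * of_real v)) = (CLINT r|PiM {1..K} Q. exp (s * of_real (V r)))"
      unfolding D_def by (rule integral_distr[OF Vm]) measurable
    also have "\<dots> = (CLINT r|PiM {1..K} Q. (\<Prod>k\<in>{1..K}. exp (s * of_real (ln (1 + max 0 (r k))))))"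
      by (simp add: V_def sum_distrib_left exp_sum)
    also have "\<dots> = (\<Prod>k\<in>{1..K}. (CLINT r|Q k. exp (s * of_real (ln (1 + max 0 r)))))"
    proof (rule PQ.product_integral_prod)
      fix k
      have "norm (exp (s * of_real (ln (1 + max 0 r)))) \<le> 1" for r :: real
        using s by (simp add: mult_nonpos_nonneg)
      then show "integrable (Q k) (\<lambda>r. exp (s * of_real (ln (1 + max 0 r))))"
        by (intro Q.integrable_const_bound[where B = 1]) auto
    qed simp
    also have "\<dots> = (\<Prod>k\<in>{1..K}. E k s)"
      by (intro prod.cong) (auto simp: E_def gamma_mellin_def Q_def)
    finally show ?thesis .
  qed
  have Em [measurable]: "(\<lambda>y. E k (Complex c y)) \<in> borel_measurable borel" if "k \<in> {1..K}" for k
    unfolding E_def using \<Omega>[OF that] n[OF that] by (intro measurable_gamma_mellin) auto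
  have [measurable]: "(\<lambda>y. Complex c y) \<in> borel_measurable borel"
    unfolding borel_measurable_complex_iff by simp
  have E1: "norm (E k (Complex c y)) \<le> 1" if "k \<in> {1..K}" for k y
    unfolding E_def using \<Omega>[OF that] n[OF that] c by (intro norm_gamma_mellin_le_1) auto
  have int: "integrable lborel (\<lambda>y. (CLINT v|D. exp (Complex c y * of_real v)) / (- Complex c y))"
  proof -
    obtain B where B: "\<And>y. \<bar>y\<bar> * norm (E 1 (Complex c y)) \<le> B"
      unfolding E_def using gamma_mellin_decay[of "\<Omega> 1" c "n 1"] \<Omega>[of 1] n[of 1] K c by auto
    \<comment> \<open>Only the factor k = 1 is used for decay; the others are bounded by 1.\<close>
    have split: "(\<Prod>k\<in>{1..K}. E k s) = E 1 s * (\<Prod>k\<in>{2..K}. E k s)" for s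
      using K by (subst prod.atLeast_Suc_atMost) (auto simp: numeral_2_eq_2)
    have P1: "norm (\<Prod>k\<in>A. E k (Complex c y)) \<le> 1" if "A \<subseteq> {1..K}" for A y
      unfolding prod_norm[symmetric] using that E1 by (intro prod_le_1) auto
    have cy: "norm (Complex c y) \<ge> \<bar>c\<bar>" "norm (Complex c y) \<ge> \<bar>y\<bar>" for y
      using abs_Re_le_cmod[of "Complex c y"] abs_Im_le_cmod[of "Complex c y"] by auto
    have cy0: "norm (Complex c y) > 0" for y using cy(1)[of y] c by linarith
    have "integrable lborel (\<lambda>y. (\<Prod>k\<in>{1..K}. E k (Complex c y)) / (- Complex c y))"
    proof (rule integrable_inverse_square_decay)
      show "(\<lambda>y. (\<Prod>k\<in>{1..K}. E k (Complex c y)) / (- Complex c y)) \<in> borel_measurable borel"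
        by measurable
      fix y
      have "norm ((\<Prod>k\<in>{1..K}. E k (Complex c y)) / (- Complex c y)) = norm (\<Prod>k\<in>{1..K}. E k (Complex c y)) / norm (Complex c y)"
        by (simp add: norm_divide)
      also have "\<dots> \<le> 1 / \<bar>c\<bar>"
        using P1[OF order_refl, of y] cy(1)[of y] c by (intro frac_le) auto
      finally show "norm ((\<Prod>k\<in>{1..K}. E k (Complex c y)) / (- Complex c y)) \<le> 1 / \<bar>c\<bar>" .
      have B0: "B \<ge> 0" using B[of 0] by simp
      have "\<bar>y\<bar> * norm (\<Prod>k\<in>{1..K}. E k (Complex c y)) = (\<bar>y\<bar> * norm (E 1 (Complex c y))) * norm (\<Prod>k\<in>{2..K}. E k (Complex c y))"
        by (simp only: split norm_mult mult.assoc)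
      also have "\<dots> \<le> B * 1"
        using P1[of "{2..K}" y] B0 by (intro mult_mono B) auto
      finally have yP: "\<bar>y\<bar> * norm (\<Prod>k\<in>{1..K}. E k (Complex c y)) \<le> B" by simp
      have "y\<^sup>2 * norm ((\<Prod>k\<in>{1..K}. E k (Complex c y)) / (- Complex c y))
          = (\<bar>y\<bar> * norm (\<Prod>k\<in>{1..K}. E k (Complex c y))) * (\<bar>y\<bar> / norm (Complex c y))"
      proof -
        \<comment> \<open>One factor |y| is absorbed by the decay of the product of transforms, the
          other by |s| >= |y|.\<close>
        have "y\<^sup>2 = \<bar>y\<bar> * \<bar>y\<bar>" by (simp add: power2_eq_square)
        then show ?thesis by (simp only: norm_divide norm_minus_cancel times_divide_eq_left times_divide_eq_right mult_ac)
      qed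
      also have "\<dots> \<le> B * 1"
        using yP cy(2)[of y] cy0[of y] B0 by (intro mult_mono) auto
      finally show "y\<^sup>2 * norm ((\<Prod>k\<in>{1..K}. E k (Complex c y)) / (- Complex c y)) \<le> B" by simp
    qed
    then show ?thesis using c by (simp add: char)
  qed
  have P: "(\<Prod>k\<in>{1..K}. \<Omega> k) > 0" using \<Omega> by (intro prod_pos) auto
  have "complex_of_real (prod_gamma_cdf K (\<lambda>k. real (n k)) \<Omega> x) = 1 / (2 * pi) *
      (CLBINT y. (CLINT v|D. exp (Complex c y * of_real v)) / (- Complex c y) * exp (- Complex c y * of_real (ln x)))"
    unfolding cdf[symmetric] by (rule mellin_inversion_cdf[OF rD nnD c int])
  also have "(CLBINT y. (CLINT v|D. exp (Complex c y * of_real v)) / (- Complex c y) * exp (- Complex c y * of_real (ln x)))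
    = (CLBINT y. Y_kernel K 1 1 (K + 1) (\<lambda>_. (1, 1, 0, 1))
        (\<lambda>j. if j = K + 1 then (0, 1, 0, 1) else (1, 1, 1 / \<Omega> j, real (n j))) (Complex c y)
       * complex_of_real (x / (\<Prod>k\<in>{1..K}. \<Omega> k)) powr (- Complex c y))"
  proof (intro Bochner_Integration.integral_cong refl)
    fix y
    define s where "s = Complex c y"
    have s: "Re s < 0" using c by (simp add: s_def)
    let ?P = "\<Prod>k\<in>{1..K}. \<Omega> k"
    \<comment> \<open>The scales cancel: p^(-s) from the kernel times (x / p)^(-s) is x^(-s). This
      is why the argument of the function is x divided by the product of the \<Omega>_k.\<close>
    have "exp (- s * of_real (ln p)) * complex_of_real (x / p) powr (- s) = exp (- s * of_real (ln x))"
      if p: "p > 0" for p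
    proof -
      have "complex_of_real (x / p) powr (- s) = exp (- s * of_real (ln (x / p)))"
        using x p by (subst powr_def) (auto simp: Ln_of_real simp del: of_real_divide)
      then show ?thesis
        using x p by (simp add: ln_div algebra_simps flip: exp_add)
    qed
    from this[OF P] have pw: "exp (- s * of_real (ln ?P)) * complex_of_real (x / ?P) powr (- s) = exp (- s * of_real (ln x))" .
    have "Y_kernel K 1 1 (K + 1) (\<lambda>_. (1, 1, 0, 1))
        (\<lambda>j. if j = K + 1 then (0, 1, 0, 1) else (1, 1, 1 / \<Omega> j, real (n j))) s
      = exp (- s * of_real (ln ?P)) * (\<Prod>k\<in>{1..K}. E k s) / (- s)"
      unfolding E_def using \<Omega> n s by (intro Y_kernel_gamma) (auto simp: Suc_le_eq)
    then have "Y_kernel K 1 1 (K + 1) (\<lambda>_. (1, 1, 0, 1))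
        (\<lambda>j. if j = K + 1 then (0, 1, 0, 1) else (1, 1, 1 / \<Omega> j, real (n j))) s
        * complex_of_real (x / ?P) powr (- s)
      = (exp (- s * of_real (ln ?P)) * complex_of_real (x / ?P) powr (- s)) * ((\<Prod>k\<in>{1..K}. E k s) / (- s))"
      by (simp only: times_divide_eq_left times_divide_eq_right mult_ac)
    also have "\<dots> = (CLINT v|D. exp (s * of_real v)) / (- s) * exp (- s * of_real (ln x))"
      unfolding pw char[OF s] by (rule mult.commute)
    finally show "(CLINT v|D. exp (Complex c y * of_real v)) / (- Complex c y) * exp (- Complex c y * of_real (ln x))
      = Y_kernel K 1 1 (K + 1) (\<lambda>_. (1, 1, 0, 1))
        (\<lambda>j. if j = K + 1 then (0, 1, 0, 1) else (1, 1, 1 / \<Omega> j, real (n j))) (Complex c y)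
       * complex_of_real (x / ?P) powr (- Complex c y)"
      unfolding s_def ..
  qed
  finally show ?thesis unfolding foxY_def by simp
qed

theorem theorem1:
  fixes K m :: nat
    and \<sigma>2 P lam :: "nat \<Rightarrow> real"
    and N0 :: real
    and M :: "'a measure"
    and \<theta> :: "nat \<Rightarrow> nat \<Rightarrow> 'a \<Rightarrow> complex"
    and habs \<gamma> :: "nat \<Rightarrow> 'a \<Rightarrow> real"
    and G :: "'a \<Rightarrow> real"
    and \<Omega> w :: "nat \<Rightarrow> real"
    and S :: real
    and W :: "(nat \<Rightarrow> nat) \<Rightarrow> real"
    and L :: "(nat \<Rightarrow> nat) set"
    and FA :: "(nat \<Rightarrow> nat) \<Rightarrow> real \<Rightarrow> real"
  assumes "K \<ge> 1" and "m \<ge> 1"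
    and "\<forall>k\<in>{1..K}. \<sigma>2 k > 0 \<and> P k > 0 \<and> 0 \<le> lam k \<and> lam k < 1"
    and "N0 > 0"
    and "prob_space M"
    and "prob_space.indep_vars M (\<lambda>_. borel) (\<lambda>kl. \<theta> (fst kl) (snd kl)) ({0..K} \<times> {1..m})"
    and "\<forall>k\<in>{0..K}. \<forall>l\<in>{1..m}.
           distributed M lborel (\<theta> k l) (\<lambda>z. ennreal (cscg_density z))"
  defines "habs \<equiv> \<lambda>k \<omega>. sqrt (\<sigma>2 k / m) *
             sqrt (\<Sum>l\<in>{1..m}. (cmod (complex_of_real (sqrt (1 - (lam k)\<^sup>2)) * \<theta> k l \<omega>
                                       + complex_of_real (lam k) * \<theta> 0 l \<omega>))\<^sup>2)"
    and "\<gamma> \<equiv> \<lambda>k \<omega>. P k * (habs k \<omega>)\<^sup>2 / N0"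
    and "G \<equiv> \<lambda>\<omega>. \<Prod>k\<in>{1..K}. 1 + \<gamma> k \<omega>"
    and "\<Omega> \<equiv> \<lambda>k. P k * \<sigma>2 k * (1 - (lam k)\<^sup>2) / (m * N0)"
    and "S \<equiv> 1 + (\<Sum>l\<in>{1..K}. (lam l)\<^sup>2 / (1 - (lam l)\<^sup>2))"
    and "w \<equiv> \<lambda>k. (lam k)\<^sup>2 / (1 - (lam k)\<^sup>2) / S"
    and "W \<equiv> \<lambda>ell::nat \<Rightarrow> nat. Gamma (real m + real (\<Sum>k\<in>{1..K}. ell k)) / Gamma (real m)
             * S powr (- real m) * (\<Prod>k\<in>{1..K}. w k ^ ell k / fact (ell k))"
    and "L \<equiv> {ell::nat \<Rightarrow> nat. \<forall>k. k \<notin> {1..K} \<longrightarrow> ell k = 0}"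
    and "FA \<equiv> \<lambda>ell x. prod_gamma_cdf K (\<lambda>k. real (m + ell k)) \<Omega> x"
  shows "(\<forall>x::real. ((\<lambda>ell. W ell * FA ell x) has_sum measure M {\<omega> \<in> space M. G \<omega> \<le> x}) L)
       \<and> (\<forall>ell\<in>L. \<forall>x::real. x > 0 \<longrightarrow> (\<forall>c::real. c < 0 \<longrightarrow>
            complex_of_real (FA ell x) =
            foxY K 1 1 (K + 1)
              (\<lambda>_. (1, 1, 0, 1))
              (\<lambda>j. if j = K + 1 then (0, 1, 0, 1) else (1, 1, 1 / \<Omega> j, real (m + ell j)))
              c (x / (\<Prod>k\<in>{1..K}. \<Omega> k))))"
proof -
  have pos: "\<sigma>2 k > 0" "P k > 0" "0 \<le> lam k" "lam k < 1" if "k \<in> {1..K}" for k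
    using assms(3) that by auto
  have lam: "1 - (lam k)\<^sup>2 > 0" if "k \<in> {1..K}" for k
    using pos(3,4)[OF that] by (simp add: power_less_one_iff abs_square_less_1)
  have \<Omega>: "\<Omega> k > 0" if "k \<in> {1..K}" for k
    using pos[OF that] lam[OF that] assms(2,4) by (auto simp: \<Omega>_def intro!: divide_pos_pos mult_pos_pos)
  \<comment> \<open>Chosen so that \<mu>^2 is the ratio occurring in S and w. Pulling sqrt (1 -
    lam^2) out of each coordinate leaves a unit coefficient on theta_k, and the extracted factor
    goes into \<Omega>.\<close>
  define \<mu> where "\<mu> k = lam k / sqrt (1 - (lam k)\<^sup>2)" for k
  have \<mu>: "(\<mu> k)\<^sup>2 = (lam k)\<^sup>2 / (1 - (lam k)\<^sup>2)" if "k \<in> {1..K}" for k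
    using lam[OF that] by (simp add: \<mu>_def power_divide)
  have S': "S = 1 + (\<Sum>k\<in>{1..K}. (\<mu> k)\<^sup>2)"
    unfolding S_def using \<mu> by simp
  have \<gamma>: "\<gamma> k \<omega> = \<Omega> k * (\<Sum>l\<in>{1..m}. (cmod (\<theta> k l \<omega> + of_real (\<mu> k) * \<theta> 0 l \<omega>))\<^sup>2)"
    if k: "k \<in> {1..K}" for k \<omega>
  proof -
    let ?r = "sqrt (1 - (lam k)\<^sup>2)"
    have r: "?r > 0" "?r\<^sup>2 = 1 - (lam k)\<^sup>2" using lam[OF k] by auto
    have "(cmod (of_real ?r * \<theta> k l \<omega> + of_real (lam k) * \<theta> 0 l \<omega>))\<^sup>2
        = (1 - (lam k)\<^sup>2) * (cmod (\<theta> k l \<omega> + of_real (\<mu> k) * \<theta> 0 l \<omega>))\<^sup>2" for l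
    proof -
      have "of_real ?r * \<theta> k l \<omega> + of_real (lam k) * \<theta> 0 l \<omega> = of_real ?r * (\<theta> k l \<omega> + of_real (\<mu> k) * \<theta> 0 l \<omega>)"
        using r(1) by (simp add: \<mu>_def distrib_left)
      then show ?thesis using r by (simp add: norm_mult power_mult_distrib)
    qed
    then have "(habs k \<omega>)\<^sup>2 = \<sigma>2 k / m * ((1 - (lam k)\<^sup>2) * (\<Sum>l\<in>{1..m}. (cmod (\<theta> k l \<omega> + of_real (\<mu> k) * \<theta> 0 l \<omega>))\<^sup>2))"
      unfolding habs_def using pos[OF k] lam[OF k]
      by (simp add: power_mult_distrib sum_distrib_left sum_nonneg)
    then show ?thesis by (simp add: \<gamma>_def \<Omega>_def)
  qed
  have W: "W ell = Gamma (real m + real (\<Sum>k\<in>{1..K}. ell k)) / Gamma (real m) * S powr (- real m)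
      * (\<Prod>k\<in>{1..K}. ((\<mu> k)\<^sup>2 / S) ^ ell k / fact (ell k))" for ell
    unfolding W_def w_def using \<mu> by simp
  show ?thesis
  proof (intro conjI allI ballI impI)
    fix x :: real
    have "G \<omega> = (\<Prod>k\<in>{1..K}. 1 + \<Omega> k * (\<Sum>l\<in>{1..m}. (cmod (\<theta> k l \<omega> + of_real (\<mu> k) * \<theta> 0 l \<omega>))\<^sup>2))" for \<omega>
      unfolding G_def using \<gamma> by simp
    moreover have "distributed M lborel (\<theta> k l) (\<lambda>z. ennreal (cscg_density z))" if "k \<in> {0..K}" "l \<in> {1..m}" for k l
      using assms(7) that by blast
    ultimately show "((\<lambda>ell. W ell * FA ell x) has_sum measure M {\<omega> \<in> space M. G \<omega> \<le> x}) L"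
      using cdf_prod_gamma_mixture[OF assms(5,2,6) _ \<Omega>, where \<mu> = \<mu> and x = x]
      unfolding W FA_def L_def S' by simp
  next
    fix ell and x c :: real
    assume "ell \<in> L" and "x > 0" and "c < 0"
    show "complex_of_real (FA ell x) =
        foxY K 1 1 (K + 1)
          (\<lambda>_. (1, 1, 0, 1))
          (\<lambda>j. if j = K + 1 then (0, 1, 0, 1) else (1, 1, 1 / \<Omega> j, real (m + ell j)))
          c (x / (\<Prod>k\<in>{1..K}. \<Omega> k))"
      unfolding FA_def using assms(1,2) \<open>x > 0\<close> \<open>c < 0\<close> by (intro prod_gamma_cdf_eq_foxY \<Omega>) auto
  qed
qed

end
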